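(* Let $I=[0,1]$ and let $\varphi,h\colon I\to I$ be commuting onto continuous functions such that $\varphi$ is piecewise monotone and $h$ is a homeomorphism. Let $a,b\ge0$ be integers, $n,m\in\mathbb{N}$, and let $f,g\colon I\to I$ be the maps $f=h^a\circ\varphi^n$ and $g=h^b\circ\varphi^m$. Let $G\colon\varprojlim(I,f)\to\varprojlim(I,f)$ be defined by $$G((x_0,x_1,x_2,\ldots))=(g(x_1),g(x_2),\ldots)$$ for all $(x_0,x_1,x_2,\ldots)\in\varprojlim(I,f)$. Then $$\mathrm{Ent}(G)=|m-n|\cdot\mathrm{Ent}(\varphi).$$
   Context: $\mathbb{N}=\{1,2,\ldots\}$; powers denote iterates. Functions commute if $\varphi\circ h=h\circ\varphi$. A continuous $\varphi\colon I\to I$ is piecewise monotone if there are points $0=c_0<c_1<\dots<c_k=1$ such that $\varphi|_{[c_i,c_{i+1}]}$ is one-to-one for every $i\in\{0,\ldots,k-1\}$. Inverse limit: $\varprojlim(I,f)=\{(x_0,x_1,x_2,\ldots)\in\prod_{i\ge0}I: f(x_i)=x_{i-1}\text{ for all }i\in\mathbb{N}\}$ with the product topology (a compact connected metrizable space). $\mathrm{Ent}$ denotes topological entropy of a continuous self-map of a compact metric space: $\mathrm{Ent}(F)=\lim_{\varepsilon\to0}\limsup_{n\to\infty}\frac1n\log s_{n,\varepsilon}(F)$, where $s_{n,\varepsilon}(F)$ is the largest cardinality of a set of $n$-orbits $(x,F(x),\ldots,F^{n-1}(x))$ any two distinct members of which differ by at least $\varepsilon$ in some coordinate. *)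

theory Defs
  imports "HOL-Analysis.Analysis"
begin

text \<open>Throughout, a self-map of a set \<open>X\<close> is a HOL function on the ambient type that maps \<open>X\<close> into
  \<open>X\<close>; its values outside \<open>X\<close> play no role.\<close>

text \<open>Continuity is assumed separately.\<close>

definition piecewise_monotone :: "(real \<Rightarrow> real) \<Rightarrow> bool" where
  "piecewise_monotone \<phi> \<longleftrightarrow>
     (\<exists>k c. c 0 = 0 \<and> c k = 1 \<and>
        (\<forall>i<k. c i < c (Suc i) \<and> inj_on \<phi> {c i..c (Suc i)}))"

definition inverse_limit :: "'a set \<Rightarrow> ('a \<Rightarrow> 'a) \<Rightarrow> (nat \<Rightarrow> 'a) set" where
  "inverse_limit X f = {x. (\<forall>i. x i \<in> X) \<and> (\<forall>i. f (x (Suc i)) = x i)}"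

definition orbit_segment :: "nat \<Rightarrow> ('a \<Rightarrow> 'a) \<Rightarrow> 'a \<Rightarrow> 'a list" where
  "orbit_segment n F x = map (\<lambda>i. (F ^^ i) x) [0..<n]"

definition separated_orbits ::
  "'a::metric_space set \<Rightarrow> ('a \<Rightarrow> 'a) \<Rightarrow> nat \<Rightarrow> real \<Rightarrow> 'a list set \<Rightarrow> bool" where
  "separated_orbits X F n \<epsilon> S \<longleftrightarrow>
     S \<subseteq> orbit_segment n F ` X \<and>
     (\<forall>u\<in>S. \<forall>v\<in>S. u \<noteq> v \<longrightarrow> (\<exists>i<n. dist (u ! i) (v ! i) \<ge> \<epsilon>))"

text \<open>If \<open>X\<close> is compact, \<open>F\<close> is continuous on \<open>X\<close> and \<open>\<epsilon> > 0\<close>, every separated set is finite and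
  the cardinalities are bounded, so the maximum below is attained. It is only meant to be used in
  that situation.\<close>

definition max_separated ::
  "'a::metric_space set \<Rightarrow> ('a \<Rightarrow> 'a) \<Rightarrow> nat \<Rightarrow> real \<Rightarrow> nat" where
  "max_separated X F n \<epsilon> = Max {card S |S. finite S \<and> separated_orbits X F n \<epsilon> S}"

text \<open>The topological entropy of a continuous self-map \<open>F\<close> of a nonempty compact set \<open>X\<close>, with
  respect to the metric of the ambient type. It depends on that metric only through the topology of
  \<open>X\<close>. On \<open>nat \<Rightarrow> real\<close> the metric is the one of the type class instance for countable products,
  which induces the product topology.\<close>

definition Ent :: "'a::metric_space set \<Rightarrow> ('a \<Rightarrow> 'a) \<Rightarrow> ereal" where
  "Ent X F =
     Lim (at_right 0)
       (\<lambda>\<epsilon>. limsup (\<lambda>n. ereal (1 / real n * ln (real (max_separated X F n \<epsilon>)))))"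

end

theory Submission
  imports Defs "HOL-Real_Asymp.Real_Asymp"
begin

text \<open>
  On \<open>X = inverse_limit {0..1} f\<close> the shift \<open>x \<mapsto> (\<lambda>i. x (Suc i))\<close> inverts the coordinatewise
  action of \<open>f\<close>, so \<open>G\<close> acts coordinatewise as the quotient of \<open>g\<close> by \<open>f\<close>. If \<open>n \<le> m\<close>, the
  quotient is an honest interval map \<open>\<psi> = h\<^sup>b\<^sup>-\<^sup>a \<circ> \<phi>\<^sup>m\<^sup>-\<^sup>n\<close> (with a negative power of \<open>h\<close> read as a
  power of its inverse) and \<open>G\<close> is its coordinatewise action. If \<open>m < n\<close>, the roles of \<open>f\<close> and \<open>g\<close>
  are exchanged and \<open>G\<close> is the inverse of the coordinatewise action of \<open>\<psi> = h\<^sup>a\<^sup>-\<^sup>b \<circ> \<phi>\<^sup>n\<^sup>-\<^sup>m\<close>; a bijection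
  and its inverse have the same entropy, because separated orbits can be run backwards
  (\<open>Ent_inverse\<close>). A coordinatewise action on \<open>X\<close> has the entropy of the map on the interval
  (\<open>Ent_inverse_limit\<close>): up to a small error a point of \<open>X\<close> is known from one late coordinate.

  What remains is \<open>Ent (H \<circ> \<phi>\<^sup>k) = k * Ent \<phi>\<close> for a homeomorphism \<open>H\<close> that commutes with \<open>\<phi>\<close>. The
  \<open>q\<close>-th iterate of \<open>H \<circ> \<phi>\<^sup>k\<close> is \<open>H\<^sup>q \<circ> \<phi>\<^sup>k\<^sup>q\<close>, which is injective on exactly the same sets as \<open>\<phi>\<^sup>k\<^sup>q\<close>.
  So it suffices that the entropy of an interval map is controlled by the sets on which its iterates
  are injective (\<open>Ent_le_of_injectivity\<close>), an elementary form of the theorem of Misiurewicz and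
  Szlenk that entropy is the growth rate of the number of monotone pieces. Two counts prove it.
  On an interval where the \<open>n\<close>-th iterate of \<open>A\<close> is injective, all earlier iterates are monotone, so
  the interval carries at most \<open>n / \<epsilon> + 2\<close> points that are \<open>(n, \<epsilon>)\<close>-separated: the polynomial
  factor does not affect the growth rate. Conversely, cut the interval into finitely many pieces
  on each of which \<open>B\<close> is injective; a ball of small radius meets at most five of them, so the number
  of itineraries of length \<open>s\<close> is at most \<open>5\<^sup>s\<close> times the number of separated orbits. The factor \<open>5\<^sup>s\<close>
  costs \<open>ln 5\<close> in the growth rate, but only \<open>ln 5 / r\<close> when \<open>B\<close> is replaced by \<open>B\<^sup>r\<close>, and \<open>r\<close> is
  arbitrary.
\<close>

section \<open>Iterates of a self-map\<close>

lemma funpow_in: "F ` X \<subseteq> X \<Longrightarrow> x \<in> X \<Longrightarrow> (F ^^ j) x \<in> X"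
  by (induction j) auto

lemma funpow_eq_on:
  assumes "F ` X \<subseteq> X" "\<And>x. x \<in> X \<Longrightarrow> F x = F' x" "x \<in> X"
  shows "(F ^^ j) x = (F' ^^ j) x"
proof (induction j)
  case (Suc j)
  have "(F ^^ Suc j) x = F' ((F ^^ j) x)" using assms(2) funpow_in[OF assms(1,3)] by simp
  then show ?case using Suc by simp
qed simp

lemma funpow_left_inverse:
  assumes "F ` X \<subseteq> X" "\<And>x. x \<in> X \<Longrightarrow> H (F x) = x" "x \<in> X"
  shows "(H ^^ j) ((F ^^ j) x) = x"
proof (induction j)
  case (Suc j)
  have "(H ^^ Suc j) ((F ^^ Suc j) x) = (H ^^ j) (H (F ((F ^^ j) x)))"
    by (simp add: funpow_swap1)
  then show ?case using assms(2)[OF funpow_in[OF assms(1,3)]] Suc by simp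
qed simp

lemma continuous_on_funpow:
  "continuous_on X F \<Longrightarrow> F ` X \<subseteq> X \<Longrightarrow> continuous_on X (F ^^ j)"
proof (induction j)
  case (Suc j)
  have "continuous_on X (F \<circ> F ^^ j)"
    using Suc.IH[OF Suc.prems] continuous_on_subset[OF Suc.prems(1)] funpow_in[OF Suc.prems(2)]
    by (intro continuous_on_compose) (simp_all add: image_subset_iff)
  then show ?case by simp
qed (auto intro: continuous_on_id')

lemma funpow_add_apply: "(F ^^ i) ((F ^^ j) x) = (F ^^ (i + j)) x"
  by (simp add: funpow_add)

lemma funpow_onto: "F ` X = X \<Longrightarrow> (F ^^ j) ` X = X"
proof (induction j)
  case (Suc j)
  have "(F ^^ Suc j) ` X = F ` (F ^^ j) ` X" by (simp add: image_image)
  then show ?case using Suc by simp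
qed simp

lemma funpow_commute_on:
  assumes "G ` X \<subseteq> X" and comm: "\<And>x. x \<in> X \<Longrightarrow> G (H x) = H (G x)"
    and "H ` X \<subseteq> X" and x: "x \<in> X"
  shows "(G ^^ j) (H x) = H ((G ^^ j) x)"
proof (induction j)
  case (Suc j)
  then show ?case using comm[OF funpow_in[OF assms(1) x]] by simp
qed simp

lemma funpow_comp_on:
  assumes G: "G ` X \<subseteq> X" and H: "H ` X \<subseteq> X"
    and comm: "\<And>x. x \<in> X \<Longrightarrow> G (H x) = H (G x)" and x: "x \<in> X"
  shows "((H \<circ> G) ^^ j) x = (H ^^ j) ((G ^^ j) x)"
proof (induction j)
  case (Suc j)
  have Gx: "(G ^^ j) x \<in> X" by (rule funpow_in[OF G x])
  have "G ((H ^^ j) ((G ^^ j) x)) = (H ^^ j) (G ((G ^^ j) x))"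
    using funpow_commute_on[OF H _ G Gx, of j] comm by metis
  then show ?case using Suc by simp
qed simp

lemma inj_on_funpow_on:
  assumes "H ` X \<subseteq> X" "inj_on H X"
  shows "inj_on (H ^^ j) X"
proof (induction j)
  case (Suc j)
  have "(H ^^ j) ` X \<subseteq> X" using funpow_in[OF assms(1)] by blast
  then have "inj_on (H \<circ> H ^^ j) X" using Suc assms(2) by (intro comp_inj_on) (auto intro: inj_on_subset)
  then show ?case by (simp add: comp_def)
qed simp

section \<open>Entropy through separated sets of points\<close>

definition separated_points ::
  "'a::metric_space set \<Rightarrow> ('a \<Rightarrow> 'a) \<Rightarrow> nat \<Rightarrow> real \<Rightarrow> 'a set \<Rightarrow> bool" where
  "separated_points X F n \<epsilon> T \<longleftrightarrow>
     finite T \<and> T \<subseteq> X \<and>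
     (\<forall>x\<in>T. \<forall>y\<in>T. x \<noteq> y \<longrightarrow> (\<exists>j<n. \<epsilon> \<le> dist ((F ^^ j) x) ((F ^^ j) y)))"

text \<open>Without these bounds the maximum that defines \<^const>\<open>max_separated\<close> ranges over an infinite set
  and carries no information.\<close>

definition finitely_separated :: "'a::metric_space set \<Rightarrow> ('a \<Rightarrow> 'a) \<Rightarrow> bool" where
  "finitely_separated X F \<longleftrightarrow>
     (\<forall>n. \<forall>\<epsilon>>0. \<exists>K. \<forall>T. separated_points X F n \<epsilon> T \<longrightarrow> card T \<le> K)"

definition sep_growth :: "'a::metric_space set \<Rightarrow> ('a \<Rightarrow> 'a) \<Rightarrow> real \<Rightarrow> ereal" where
  "sep_growth X F \<epsilon> =
     limsup (\<lambda>n. ereal (1 / real n * ln (real (max_separated X F n \<epsilon>))))"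

text \<open>Base points can be counted in place of orbit segments: for \<open>\<epsilon> > 0\<close> separated points have distinct
  orbit segments, and conversely one base point can be chosen for each segment.\<close>

lemma separated_orbits_cards:
  fixes X :: "'a::metric_space set"
  assumes "\<epsilon> > 0"
  shows "{card S |S. finite S \<and> separated_orbits X F n \<epsilon> S}
    = {card T |T. separated_points X F n \<epsilon> T}"
proof (intro subset_antisym subsetI)
  fix k assume "k \<in> {card S |S. finite S \<and> separated_orbits X F n \<epsilon> S}"
  then obtain S where S: "k = card S" "finite S" and sep_S: "separated_orbits X F n \<epsilon> S"
    by blast
  have S_sub: "S \<subseteq> orbit_segment n F ` X"
    and sep: "\<And>u v. u \<in> S \<Longrightarrow> v \<in> S \<Longrightarrow> u \<noteq> v \<Longrightarrow> \<exists>i<n. dist (u ! i) (v ! i) \<ge> \<epsilon>"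
    using sep_S unfolding separated_orbits_def by simp_all
  obtain T where T: "T \<subseteq> X" "inj_on (orbit_segment n F) T" "S = orbit_segment n F ` T"
    using S_sub unfolding subset_image_inj by blast
  have "\<exists>j<n. \<epsilon> \<le> dist ((F ^^ j) x) ((F ^^ j) y)" if xy: "x \<in> T" "y \<in> T" "x \<noteq> y" for x y
  proof -
    have "orbit_segment n F x \<noteq> orbit_segment n F y"
      using T(2) xy by (auto dest: inj_onD)
    then obtain i where i: "i < n" "dist (orbit_segment n F x ! i) (orbit_segment n F y ! i) \<ge> \<epsilon>"
      using sep T(3) xy by blast
    then show ?thesis by (auto simp: orbit_segment_def)
  qed
  moreover have "finite T" using T S(2) by (simp add: finite_image_iff)
  ultimately have "separated_points X F n \<epsilon> T"
    unfolding separated_points_def using T(1) by blast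
  moreover have "card S = card T" using T by (simp add: card_image)
  ultimately show "k \<in> {card T |T. separated_points X F n \<epsilon> T}" using S(1) by blast
next
  fix k assume "k \<in> {card T |T. separated_points X F n \<epsilon> T}"
  then obtain T where k: "k = card T" and sep_T: "separated_points X F n \<epsilon> T"
    by blast
  have T: "finite T" "T \<subseteq> X"
    and sep: "\<And>x y. x \<in> T \<Longrightarrow> y \<in> T \<Longrightarrow> x \<noteq> y \<Longrightarrow> \<exists>j<n. \<epsilon> \<le> dist ((F ^^ j) x) ((F ^^ j) y)"
    using sep_T unfolding separated_points_def by simp_all
  have nth: "orbit_segment n F x ! j = (F ^^ j) x" if "j < n" for x j
    using that by (simp add: orbit_segment_def)
  have inj: "inj_on (orbit_segment n F) T"
  proof (rule inj_onI, rule ccontr)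
    fix x y assume xy: "x \<in> T" "y \<in> T" "orbit_segment n F x = orbit_segment n F y" "x \<noteq> y"
    then obtain j where j: "j < n" "\<epsilon> \<le> dist ((F ^^ j) x) ((F ^^ j) y)" using sep by blast
    then have "(F ^^ j) x = (F ^^ j) y" using xy(3) nth by metis
    then show False using j assms by simp
  qed
  have "separated_orbits X F n \<epsilon> (orbit_segment n F ` T)"
    unfolding separated_orbits_def
  proof (intro conjI ballI impI)
    show "orbit_segment n F ` T \<subseteq> orbit_segment n F ` X" using T(2) by blast
    fix u v assume uv: "u \<in> orbit_segment n F ` T" "v \<in> orbit_segment n F ` T" "u \<noteq> v"
    then obtain x y where xy: "x \<in> T" "y \<in> T" "u = orbit_segment n F x" "v = orbit_segment n F y"
      by blast
    then obtain j where "j < n" "\<epsilon> \<le> dist ((F ^^ j) x) ((F ^^ j) y)" using sep uv(3) by blast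
    then show "\<exists>i<n. dist (u ! i) (v ! i) \<ge> \<epsilon>" using xy nth by metis
  qed
  moreover have "card T = card (orbit_segment n F ` T)" using inj by (simp add: card_image)
  ultimately show "k \<in> {card S |S. finite S \<and> separated_orbits X F n \<epsilon> S}"
    using T(1) k by blast
qed

lemma max_separated_eq:
  "\<epsilon> > 0 \<Longrightarrow> max_separated X F n \<epsilon> = Max {card T |T. separated_points X F n \<epsilon> T}"
  unfolding max_separated_def by (simp add: separated_orbits_cards)

lemma finite_separated_cards:
  assumes "finitely_separated X F" "\<epsilon> > 0"
  shows "finite {card T |T. separated_points X F n \<epsilon> T}"
proof -
  obtain K where "\<And>T. separated_points X F n \<epsilon> T \<Longrightarrow> card T \<le> K"
    using assms unfolding finitely_separated_def by blast
  then have "{card T |T. separated_points X F n \<epsilon> T} \<subseteq> {..K}" by auto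
  then show ?thesis by (rule finite_subset) simp
qed

lemma card_le_max_separated:
  assumes "finitely_separated X F" "\<epsilon> > 0" "separated_points X F n \<epsilon> T"
  shows "card T \<le> max_separated X F n \<epsilon>"
  unfolding max_separated_eq[OF assms(2)]
  using finite_separated_cards[OF assms(1,2)] assms(3) by (intro Max_ge) auto

lemma max_separated_attained:
  assumes "finitely_separated X F" "\<epsilon> > 0"
  obtains T where "separated_points X F n \<epsilon> T" "card T = max_separated X F n \<epsilon>"
proof -
  have "separated_points X F n \<epsilon> {}" by (simp add: separated_points_def)
  then have "{card T |T. separated_points X F n \<epsilon> T} \<noteq> {}" by blast
  from Max_in[OF finite_separated_cards[OF assms] this] show thesis
    unfolding max_separated_eq[OF assms(2), symmetric] using that by auto
qed

lemma max_separated_ge_1: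
  assumes "finitely_separated X F" "\<epsilon> > 0" "X \<noteq> {}"
  shows "1 \<le> max_separated X F n \<epsilon>"
proof -
  obtain x where "x \<in> X" using assms(3) by blast
  then have "separated_points X F n \<epsilon> {x}" by (simp add: separated_points_def)
  from card_le_max_separated[OF assms(1,2) this] show ?thesis by simp
qed

text \<open>A largest separated set spans: a point whose orbit stayed \<open>\<epsilon>\<close>-far from all of its members
  could be added to it.\<close>

lemma max_separated_spanning:
  assumes fin: "finitely_separated X F" and \<epsilon>: "\<epsilon> > 0"
  obtains T where "separated_points X F n \<epsilon> T" "card T = max_separated X F n \<epsilon>"
    "\<And>x. x \<in> X \<Longrightarrow> \<exists>y\<in>T. \<forall>j<n. dist ((F ^^ j) x) ((F ^^ j) y) < \<epsilon>"
proof -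
  obtain T where T: "separated_points X F n \<epsilon> T" "card T = max_separated X F n \<epsilon>"
    using max_separated_attained[OF assms] .
  have "\<exists>y\<in>T. \<forall>j<n. dist ((F ^^ j) x) ((F ^^ j) y) < \<epsilon>" if x: "x \<in> X" for x
  proof (rule ccontr)
    assume "\<not> ?thesis"
    then have far: "\<And>y. y \<in> T \<Longrightarrow> \<exists>j<n. \<epsilon> \<le> dist ((F ^^ j) x) ((F ^^ j) y)"
      by (meson not_less)
    have "x \<notin> T" using far \<epsilon> by force
    moreover have "separated_points X F n \<epsilon> (insert x T)"
      using T(1) far x unfolding separated_points_def by (auto simp: dist_commute)
    ultimately have "Suc (card T) \<le> max_separated X F n \<epsilon>"
      using card_le_max_separated[OF assms, of n "insert x T"] T(1)
      by (simp add: separated_points_def)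
    then show False using T(2) by simp
  qed
  then show thesis using that T by blast
qed

lemma separated_points_antimono:
  "separated_points X F n \<epsilon> T \<Longrightarrow> \<delta> \<le> \<epsilon> \<Longrightarrow> separated_points X F n \<delta> T"
  unfolding separated_points_def by (meson order_trans)

lemma max_separated_antimono:
  assumes "finitely_separated X F" "0 < \<delta>" "\<delta> \<le> \<epsilon>"
  shows "max_separated X F n \<epsilon> \<le> max_separated X F n \<delta>"
proof -
  have "\<epsilon> > 0" using assms by simp
  then obtain T where "separated_points X F n \<epsilon> T" "card T = max_separated X F n \<epsilon>"
    using max_separated_attained[OF assms(1)] by blast
  then show ?thesis
    using card_le_max_separated[OF assms(1,2)] separated_points_antimono assms(3) by metis
qed

lemma growth_rate_mono:
  fixes s s' :: "nat \<Rightarrow> nat"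
  assumes "\<And>n. 1 \<le> s n" "\<And>n. s n \<le> s' n"
  shows "limsup (\<lambda>n. ereal (1 / real n * ln (real (s n))))
    \<le> limsup (\<lambda>n. ereal (1 / real n * ln (real (s' n))))"
proof (intro Limsup_mono always_eventually allI)
  fix n
  have "1 \<le> s n" "s n \<le> s' n" using assms by auto
  then have "ln (real (s n)) \<le> ln (real (s' n))" by simp
  then show "ereal (1 / real n * ln (real (s n))) \<le> ereal (1 / real n * ln (real (s' n)))"
    by (simp add: divide_right_mono)
qed

text \<open>The growth rate increases as \<open>\<epsilon>\<close> decreases, so its limit at \<open>0\<close> exists and is the supremum.\<close>

lemma Ent_eq_SUP:
  assumes fin: "finitely_separated X F" and ne: "X \<noteq> {}"
  shows "Ent X F = (SUP \<epsilon>\<in>{0<..}. sep_growth X F \<epsilon>)"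
proof -
  have mono: "sep_growth X F \<epsilon> \<le> sep_growth X F \<delta>" if "0 < \<delta>" "\<delta> \<le> \<epsilon>" for \<delta> \<epsilon>
    unfolding sep_growth_def
    using max_separated_ge_1[OF fin _ ne] max_separated_antimono[OF fin] that
    by (intro growth_rate_mono) auto
  let ?L = "SUP \<epsilon>\<in>{0<..}. sep_growth X F \<epsilon>"
  have "(sep_growth X F \<longlongrightarrow> ?L) (at_right 0)"
  proof (rule order_tendstoI)
    fix c assume "c < ?L"
    then obtain \<epsilon> where \<epsilon>: "\<epsilon> > 0" "c < sep_growth X F \<epsilon>" unfolding less_SUP_iff by auto
    show "\<forall>\<^sub>F \<delta> in at_right 0. c < sep_growth X F \<delta>"
      unfolding eventually_at_right_field
      using \<epsilon> mono by (intro exI[of _ \<epsilon>]) (auto intro: less_le_trans)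
  next
    fix c assume c: "?L < c"
    show "\<forall>\<^sub>F \<delta> in at_right 0. sep_growth X F \<delta> < c"
      unfolding eventually_at_right_field
    proof (intro exI[of _ 1] conjI allI impI)
      fix \<delta> :: real assume "0 < \<delta>"
      then have "sep_growth X F \<delta> \<le> ?L" by (intro SUP_upper) simp
      then show "sep_growth X F \<delta> < c" using c by (rule le_less_trans)
    qed simp
  qed
  then have "Lim (at_right 0) (sep_growth X F) = ?L"
    by (rule tendsto_Lim[rotated]) simp
  then show ?thesis unfolding Ent_def sep_growth_def .
qed

lemma sep_growth_le_Ent:
  assumes "finitely_separated X F" "X \<noteq> {}" "\<epsilon> > 0"
  shows "sep_growth X F \<epsilon> \<le> Ent X F"
  unfolding Ent_eq_SUP[OF assms(1,2)] using assms(3) by (intro SUP_upper) simp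

lemma Ent_leI:
  assumes "finitely_separated X F" "X \<noteq> {}" "\<And>\<epsilon>. \<epsilon> > 0 \<Longrightarrow> sep_growth X F \<epsilon> \<le> c"
  shows "Ent X F \<le> c"
  unfolding Ent_eq_SUP[OF assms(1,2)] using assms(3) by (intro SUP_least) simp

lemma Ent_nonneg:
  assumes "finitely_separated X F" "X \<noteq> {}"
  shows "0 \<le> Ent X F"
proof -
  have "0 = limsup (\<lambda>n. ereal (1 / real n * ln (real 1)))" by (simp add: Limsup_const)
  also have "\<dots> \<le> sep_growth X F 1"
    unfolding sep_growth_def using max_separated_ge_1[OF assms(1) _ assms(2)]
    by (intro growth_rate_mono) auto
  also have "\<dots> \<le> Ent X F" using sep_growth_le_Ent[OF assms] by simp
  finally show ?thesis .
qed

lemma Ent_mono: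
  assumes "finitely_separated X F" "X \<noteq> {}" "finitely_separated Y F'" "Y \<noteq> {}"
    and le: "\<And>\<epsilon>. \<epsilon> > 0 \<Longrightarrow> \<exists>\<delta>>0. \<forall>n. max_separated X F n \<epsilon> \<le> max_separated Y F' n \<delta>"
  shows "Ent X F \<le> Ent Y F'"
proof (rule Ent_leI[OF assms(1,2)])
  fix \<epsilon> :: real assume \<epsilon>: "\<epsilon> > 0"
  then obtain \<delta> where \<delta>: "\<delta> > 0" "\<And>n. max_separated X F n \<epsilon> \<le> max_separated Y F' n \<delta>"
    using le by blast
  have "sep_growth X F \<epsilon> \<le> sep_growth Y F' \<delta>"
    unfolding sep_growth_def using max_separated_ge_1[OF assms(1) \<epsilon> assms(2)] \<delta>(2)
    by (intro growth_rate_mono) auto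
  also have "\<dots> \<le> Ent Y F'" using sep_growth_le_Ent assms \<delta> by blast
  finally show "sep_growth X F \<epsilon> \<le> Ent Y F'" .
qed

lemma Ent_cong:
  assumes "F ` X \<subseteq> X" "\<And>x. x \<in> X \<Longrightarrow> F x = F' x"
  shows "Ent X F = Ent X F'"
proof -
  have "orbit_segment n F ` X = orbit_segment n F' ` X" for n
    unfolding orbit_segment_def using funpow_eq_on[OF assms] by (intro image_cong) auto
  then have "max_separated X F n \<epsilon> = max_separated X F' n \<epsilon>" for n \<epsilon>
    unfolding max_separated_def separated_orbits_def by simp
  then show ?thesis unfolding Ent_def by simp
qed

text \<open>The orbit of \<open>F\<^sup>n\<^sup>-\<^sup>1 x\<close> under the inverse \<open>H\<close> is the orbit of \<open>x\<close> run backwards, so \<open>F\<^sup>n\<^sup>-\<^sup>1\<close>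
  carries the separated sets of \<open>F\<close> to those of \<open>H\<close>.\<close>

lemma separated_points_inverse:
  assumes maps: "F ` X \<subseteq> X" "H ` X \<subseteq> X" and inv: "\<And>x. x \<in> X \<Longrightarrow> H (F x) = x"
    and T: "separated_points X F n \<epsilon> T"
  shows "\<exists>T'. separated_points X H n \<epsilon> T' \<and> card T' = card T"
proof -
  let ?N = "n - 1"
  have T': "finite T" "T \<subseteq> X" using T by (auto simp: separated_points_def)
  have cancel: "(H ^^ j) ((F ^^ (j + i)) x) = (F ^^ i) x" if "x \<in> X" for x i j
    using funpow_left_inverse[OF maps(1) inv funpow_in[OF maps(1) that], of j i] by (simp add: funpow_add)
  have inj: "inj_on (F ^^ ?N) X"
    using cancel[of _ ?N 0] by (intro inj_on_inverseI[of _ "H ^^ ?N"]) simp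
  have "separated_points X H n \<epsilon> ((F ^^ ?N) ` T)"
    unfolding separated_points_def
  proof (intro conjI ballI impI)
    show "finite ((F ^^ ?N) ` T)" using T' by simp
    show "(F ^^ ?N) ` T \<subseteq> X" using T' funpow_in[OF maps(1)] by blast
    fix u v assume uv: "u \<in> (F ^^ ?N) ` T" "v \<in> (F ^^ ?N) ` T" "u \<noteq> v"
    then obtain x y where xy: "x \<in> T" "y \<in> T" "u = (F ^^ ?N) x" "v = (F ^^ ?N) y" by blast
    then obtain j where j: "j < n" "\<epsilon> \<le> dist ((F ^^ j) x) ((F ^^ j) y)"
      using T uv(3) unfolding separated_points_def by metis
    have "(H ^^ (?N - j)) u = (F ^^ j) x" "(H ^^ (?N - j)) v = (F ^^ j) y"
      using cancel[of x "?N - j" j] cancel[of y "?N - j" j] xy T' j(1) by auto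
    then show "\<exists>j<n. \<epsilon> \<le> dist ((H ^^ j) u) ((H ^^ j) v)"
      using j by (intro exI[of _ "?N - j"]) auto
  qed
  moreover have "card ((F ^^ ?N) ` T) = card T"
    using inj T' by (intro card_image) (auto intro: inj_on_subset)
  ultimately show ?thesis by blast
qed

lemma Ent_inverse:
  assumes maps: "F ` X \<subseteq> X" "H ` X \<subseteq> X"
    and inv: "\<And>x. x \<in> X \<Longrightarrow> H (F x) = x" "\<And>x. x \<in> X \<Longrightarrow> F (H x) = x"
  shows "Ent X F = Ent X H"
proof -
  have "max_separated X F n \<epsilon> = max_separated X H n \<epsilon>" if "\<epsilon> > 0" for n \<epsilon>
  proof -
    have "{card T |T. separated_points X F n \<epsilon> T} = {card T |T. separated_points X H n \<epsilon> T}"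
      using separated_points_inverse[OF maps inv(1)]
        separated_points_inverse[OF maps(2,1) inv(2)] by (metis (no_types, lifting))
    then show ?thesis using that by (simp add: max_separated_eq)
  qed
  then have "\<forall>\<^sub>F \<epsilon> in at_right 0. sep_growth X F \<epsilon> = sep_growth X H \<epsilon>"
    unfolding sep_growth_def eventually_at_right_field by (intro exI[of _ 1]) simp
  then have "(sep_growth X F \<longlongrightarrow> l) (at_right 0) = (sep_growth X H \<longlongrightarrow> l) (at_right 0)" for l
    by (rule tendsto_cong)
  then show ?thesis unfolding Ent_def sep_growth_def Topological_Spaces.Lim_def by simp
qed

text \<open>By uniform continuity there is a \<open>\<delta>\<close> such that points at distance less than \<open>\<delta>\<close> stay \<open>\<epsilon>\<close>-close
  for \<open>n\<close> steps. So each of finitely many balls of radius \<open>\<delta> / 2\<close> that cover \<open>X\<close> contains at most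
  one point of a separated set.\<close>

lemma finitely_separated_compact:
  fixes X :: "'a::metric_space set"
  assumes X: "compact X" and F: "continuous_on X F" "F ` X \<subseteq> X"
  shows "finitely_separated X F"
  unfolding finitely_separated_def
proof (intro allI impI)
  fix n and \<epsilon> :: real assume \<epsilon>: "\<epsilon> > 0"
  have "\<exists>\<delta>>0. \<forall>x\<in>X. \<forall>y\<in>X. dist x y < \<delta> \<longrightarrow> (\<forall>j<n. dist ((F ^^ j) x) ((F ^^ j) y) < \<epsilon>)"
  proof (induction n)
    case (Suc n)
    then obtain \<delta> where \<delta>: "\<delta> > 0"
      "\<forall>x\<in>X. \<forall>y\<in>X. dist x y < \<delta> \<longrightarrow> (\<forall>j<n. dist ((F ^^ j) x) ((F ^^ j) y) < \<epsilon>)" by blast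
    have "uniformly_continuous_on X (F ^^ n)"
      using X F by (intro compact_uniformly_continuous continuous_on_funpow)
    then obtain \<delta>' where \<delta>': "\<delta>' > 0"
      "\<forall>x\<in>X. \<forall>y\<in>X. dist y x < \<delta>' \<longrightarrow> dist ((F ^^ n) y) ((F ^^ n) x) < \<epsilon>"
      unfolding uniformly_continuous_on_def using \<epsilon> by blast
    show ?case
      using \<delta> \<delta>' by (intro exI[of _ "min \<delta> \<delta>'"]) (auto simp: less_Suc_eq)
  qed (auto intro: exI[of _ 1])
  then obtain \<delta> where \<delta>: "\<delta> > 0"
    "\<And>x y j. x \<in> X \<Longrightarrow> y \<in> X \<Longrightarrow> dist x y < \<delta> \<Longrightarrow> j < n \<Longrightarrow> dist ((F ^^ j) x) ((F ^^ j) y) < \<epsilon>"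
    by blast
  obtain C where C: "finite C" "X \<subseteq> (\<Union>c\<in>C. ball c (\<delta> / 2))"
    using compactE_image[OF X, of X "\<lambda>c. ball c (\<delta> / 2)"] \<delta>(1)
    by (metis (no_types, lifting) UN_I centre_in_ball half_gt_zero open_ball subsetI)
  have "card T \<le> card C" if T: "separated_points X F n \<epsilon> T" for T
  proof -
    have TX: "finite T" "T \<subseteq> X" using T by (auto simp: separated_points_def)
    have "\<forall>x\<in>T. \<exists>c\<in>C. dist c x < \<delta> / 2" using C(2) TX by force
    then obtain \<gamma> where \<gamma>: "\<And>x. x \<in> T \<Longrightarrow> \<gamma> x \<in> C \<and> dist (\<gamma> x) x < \<delta> / 2" by metis
    have "inj_on \<gamma> T"
    proof (rule inj_onI, rule ccontr)
      fix x y assume xy: "x \<in> T" "y \<in> T" "\<gamma> x = \<gamma> y" "x \<noteq> y"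
      have "dist x y < \<delta>"
        using dist_triangle_half_r[of "\<gamma> x" x \<delta> y] \<gamma>[OF xy(1)] \<gamma>[OF xy(2)] xy(3) by simp
      then show False
        using T xy \<delta>(2)[of x y] TX unfolding separated_points_def by (meson not_less subsetD)
    qed
    then show ?thesis using \<gamma> C(1) by (intro card_inj_on_le) auto
  qed
  then show "\<exists>K. \<forall>T. separated_points X F n \<epsilon> T \<longrightarrow> card T \<le> K" by blast
qed

section \<open>Entropy on inverse limits\<close>

lemma inverse_limit_coordinate:
  assumes "x \<in> inverse_limit K f"
  shows "x i = (f ^^ j) (x (i + j))"
proof (induction j)
  case (Suc j)
  have "x (i + j) = f (x (i + Suc j))" using assms by (simp add: inverse_limit_def)
  then show ?case using Suc by (simp add: funpow_swap1)
qed simp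

lemma dist_coordinate_le:
  fixes x y :: "nat \<Rightarrow> 'a::metric_space"
  shows "(1 / 2) ^ to_nat i * min (dist (x i) (y i)) 1 \<le> dist x y"
proof -
  let ?t = "\<lambda>n. (1 / 2) ^ n * min (dist (x (from_nat n)) (y (from_nat n))) 1 :: real"
  have "summable ?t"
    by (rule summable_comparison_test'[of "\<lambda>n. (1 / 2) ^ n" 0]) (auto intro: summable_geometric)
  then have "sum ?t {to_nat i} \<le> suminf ?t" by (intro sum_le_suminf) auto
  then show ?thesis by (simp add: dist_fun_def)
qed

text \<open>The product metric sees only finitely many coordinates up to an error of \<open>\<epsilon> / 2\<close>. All of them are
  images, under iterates of \<open>f\<close>, of the last one, whose index is \<open>M\<close>.\<close>

lemma inverse_limit_dist_less:
  fixes K :: "'a::metric_space set"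
  assumes K: "compact K" and f: "continuous_on K f" "f ` K \<subseteq> K" and \<epsilon>: "\<epsilon> > 0"
  shows "\<exists>M. \<exists>\<delta>>0. \<forall>x\<in>inverse_limit K f. \<forall>y\<in>inverse_limit K f.
    dist (x M) (y M) < \<delta> \<longrightarrow> dist x y < \<epsilon>"
proof -
  obtain N where N: "(1 / 2 :: real) ^ N < \<epsilon> / 2"
    using real_arch_pow_inv[of "\<epsilon> / 2" "1 / 2"] \<epsilon> by auto
  (* The metric enumerates the index type by from_nat, so the first N + 1 terms of its series need
     not belong to the coordinates 0, ..., N. *)
  define M :: nat where "M = Max (from_nat ` {..N})"
  have "\<exists>\<delta>>0. \<forall>u\<in>K. \<forall>v\<in>K. dist u v < \<delta> \<longrightarrow> dist ((f ^^ j) u) ((f ^^ j) v) < \<epsilon> / 4" for j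
  proof -
    have "uniformly_continuous_on K (f ^^ j)"
      using K f by (intro compact_uniformly_continuous continuous_on_funpow)
    moreover have "\<epsilon> / 4 > 0" using \<epsilon> by simp
    ultimately show ?thesis unfolding uniformly_continuous_on_def by metis
  qed
  then obtain d where d: "\<And>j. d j > 0"
    "\<And>j u v. u \<in> K \<Longrightarrow> v \<in> K \<Longrightarrow> dist u v < d j \<Longrightarrow> dist ((f ^^ j) u) ((f ^^ j) v) < \<epsilon> / 4"
    by metis
  define \<delta> where "\<delta> = Min (d ` {..M})"
  have "dist x y < \<epsilon>"
    if x: "x \<in> inverse_limit K f" and y: "y \<in> inverse_limit K f" and xy: "dist (x M) (y M) < \<delta>" for x y
  proof -
    have close: "dist (x i) (y i) < \<epsilon> / 4" if "i \<le> M" for i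
    proof -
      have "\<delta> \<le> d (M - i)" unfolding \<delta>_def by (intro Min_le) auto
      moreover have "x M \<in> K" "y M \<in> K" using x y by (auto simp: inverse_limit_def)
      ultimately show ?thesis
        using d(2)[of "x M" "y M" "M - i"] xy that
          inverse_limit_coordinate[OF x, of i "M - i"] inverse_limit_coordinate[OF y, of i "M - i"]
        by simp
    qed
    have idx: "from_nat k \<le> M" if "k \<le> N" for k using that unfolding M_def by (intro Max_ge) auto
    let ?S = "{dist (x (from_nat k)) (y (from_nat k)) |k. k \<le> N}"
    have "?S = (\<lambda>k. dist (x (from_nat k)) (y (from_nat k))) ` {..N}" by auto
    then have "finite ?S" "?S \<noteq> {}" by auto
    then have "Max ?S < \<epsilon> / 4" using close idx by (subst Max_less_iff) auto
    then show ?thesis using dist_fun_le_dist_first_terms[of x y N] N by linarith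
  qed
  moreover have "\<delta> > 0" unfolding \<delta>_def using d(1) by (subst Min_gr_iff) auto
  ultimately show ?thesis by blast
qed

lemma inverse_limit_lift:
  assumes f: "f ` K = K" and y: "y \<in> K"
  shows "\<exists>x\<in>inverse_limit K f. x 0 = y"
proof -
  define x where "x i = (inv_into K f ^^ i) y" for i
  have "x i \<in> K" for i
    unfolding x_def using f y by (intro funpow_in) (auto intro: inv_into_into)
  moreover have "f (x (Suc i)) = x i" for i
    using f_inv_into_f[of "x i" f K] calculation[of i] f by (simp add: x_def)
  ultimately have "x \<in> inverse_limit K f" by (simp add: inverse_limit_def)
  moreover have "x 0 = y" by (simp add: x_def)
  ultimately show ?thesis by blast
qed

lemma funpow_coordinatewise:
  fixes \<psi> :: "'a \<Rightarrow> 'a"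
  shows "((\<lambda>x i. \<psi> (x i)) ^^ j) x = (\<lambda>i. (\<psi> ^^ j) (x i))"
  by (induction j) auto

text \<open>A late coordinate carries separated sets of the coordinatewise action to separated sets of \<open>\<psi>\<close>,
  and choosing points above those of \<open>K\<close> carries separated sets back, because the distance in the
  product bounds the distance of the \<open>0\<close>-th coordinates.\<close>

lemma Ent_inverse_limit:
  fixes K :: "'a::metric_space set"
  assumes K: "compact K" "K \<noteq> {}" and f: "continuous_on K f" "f ` K = K"
    and \<psi>: "continuous_on K \<psi>" "\<psi> ` K \<subseteq> K"
    and comm: "\<And>x. x \<in> K \<Longrightarrow> f (\<psi> x) = \<psi> (f x)"
  shows "Ent (inverse_limit K f) (\<lambda>x i. \<psi> (x i)) = Ent K \<psi>"
proof -
  let ?X = "inverse_limit K f" and ?\<Psi> = "\<lambda>(x :: nat \<Rightarrow> 'a) i. \<psi> (x i)"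
  have mem: "x i \<in> K" if "x \<in> ?X" for x i using that by (simp add: inverse_limit_def)
  have maps: "?\<Psi> ` ?X \<subseteq> ?X"
  proof (rule image_subsetI)
    fix x assume x: "x \<in> ?X"
    have "f (x (Suc i)) = x i" for i using x by (simp add: inverse_limit_def)
    then show "?\<Psi> x \<in> ?X" using mem[OF x] \<psi>(2) comm by (auto simp: inverse_limit_def)
  qed
  have iter_mem: "(?\<Psi> ^^ j) x \<in> ?X" if "x \<in> ?X" for x j using funpow_in[OF maps that] .
  have X_ne: "?X \<noteq> {}" using K(2) inverse_limit_lift[OF f(2)] by blast
  have fin_K: "finitely_separated K \<psi>" using K \<psi> by (intro finitely_separated_compact)
  have project: "\<exists>\<delta>>0. \<forall>n T. separated_points ?X ?\<Psi> n \<epsilon> T \<longrightarrow> card T \<le> max_separated K \<psi> n \<delta>"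
    if \<epsilon>: "\<epsilon> > 0" for \<epsilon>
  proof -
    have fK: "f ` K \<subseteq> K" using f(2) by simp
    obtain \<delta> M where \<delta>: "\<delta> > 0"
      "\<And>x y. x \<in> ?X \<Longrightarrow> y \<in> ?X \<Longrightarrow> dist (x M) (y M) < \<delta> \<Longrightarrow> dist x y < \<epsilon>"
      using inverse_limit_dist_less[OF K(1) f(1) fK \<epsilon>] by metis
    have "card T \<le> max_separated K \<psi> n \<delta>" if T: "separated_points ?X ?\<Psi> n \<epsilon> T" for n T
    proof -
      have TX: "finite T" "T \<subseteq> ?X" using T by (auto simp: separated_points_def)
      have far: "\<exists>j<n. \<delta> \<le> dist ((\<psi> ^^ j) (x M)) ((\<psi> ^^ j) (y M))"
        if xy: "x \<in> T" "y \<in> T" "x \<noteq> y" for x y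
      proof -
        obtain j where j: "j < n" "\<epsilon> \<le> dist ((?\<Psi> ^^ j) x) ((?\<Psi> ^^ j) y)"
          using T xy unfolding separated_points_def by blast
        have "(?\<Psi> ^^ j) x \<in> ?X" "(?\<Psi> ^^ j) y \<in> ?X" using iter_mem xy TX(2) by blast+
        then have "\<delta> \<le> dist ((?\<Psi> ^^ j) x M) ((?\<Psi> ^^ j) y M)"
          using \<delta>(2) j(2) by (meson not_less)
        then show ?thesis using j(1) unfolding funpow_coordinatewise by blast
      qed
      have inj: "inj_on (\<lambda>x. x M) T"
        using far \<delta>(1) by (intro inj_onI) (metis dist_self not_less)
      have "separated_points K \<psi> n \<delta> ((\<lambda>x. x M) ` T)"
        unfolding separated_points_def
      proof (intro conjI ballI impI)
        show "finite ((\<lambda>x. x M) ` T)" "(\<lambda>x. x M) ` T \<subseteq> K" using TX mem by auto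
        fix u v assume "u \<in> (\<lambda>x. x M) ` T" "v \<in> (\<lambda>x. x M) ` T" "u \<noteq> v"
        then obtain x y where "x \<in> T" "y \<in> T" "x \<noteq> y" "u = x M" "v = y M" by blast
        then show "\<exists>j<n. \<delta> \<le> dist ((\<psi> ^^ j) u) ((\<psi> ^^ j) v)" using far by simp
      qed
      then have "card ((\<lambda>x. x M) ` T) \<le> max_separated K \<psi> n \<delta>"
        by (rule card_le_max_separated[OF fin_K \<delta>(1)])
      then show ?thesis using inj by (simp add: card_image)
    qed
    then show ?thesis using \<delta>(1) by blast
  qed
  have fin_X: "finitely_separated ?X ?\<Psi>"
    unfolding finitely_separated_def using project by meson
  show ?thesis
  proof (rule antisym)
    show "Ent ?X ?\<Psi> \<le> Ent K \<psi>"
    proof (rule Ent_mono[OF fin_X X_ne fin_K K(2)])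
      fix \<epsilon> :: real assume \<epsilon>: "\<epsilon> > 0"
      show "\<exists>\<delta>>0. \<forall>n. max_separated ?X ?\<Psi> n \<epsilon> \<le> max_separated K \<psi> n \<delta>"
        using project[OF \<epsilon>] max_separated_attained[OF fin_X \<epsilon>] by metis
    qed
  next
    show "Ent K \<psi> \<le> Ent ?X ?\<Psi>"
    proof (rule Ent_mono[OF fin_K K(2) fin_X X_ne])
      fix \<epsilon> :: real assume \<epsilon>: "\<epsilon> > 0"
      define \<delta> where "\<delta> = (1 / 2) ^ to_nat (0::nat) * min \<epsilon> 1"
      have \<delta>: "\<delta> > 0" unfolding \<delta>_def using \<epsilon> by simp
      obtain l where lift: "\<And>y. y \<in> K \<Longrightarrow> l y \<in> ?X \<and> l y 0 = y"
        using inverse_limit_lift[OF f(2)] by metis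
      have "max_separated K \<psi> n \<epsilon> \<le> max_separated ?X ?\<Psi> n \<delta>" for n
      proof -
        obtain T where T: "separated_points K \<psi> n \<epsilon> T" "card T = max_separated K \<psi> n \<epsilon>"
          using max_separated_attained[OF fin_K \<epsilon>] .
        have TK: "finite T" "T \<subseteq> K" using T(1) by (auto simp: separated_points_def)
        have inj: "inj_on l T" using lift TK(2) by (metis inj_onI subsetD)
        have "separated_points ?X ?\<Psi> n \<delta> (l ` T)"
          unfolding separated_points_def
        proof (intro conjI ballI impI)
          show "finite (l ` T)" "l ` T \<subseteq> ?X" using TK lift by auto
          fix u v assume "u \<in> l ` T" "v \<in> l ` T" "u \<noteq> v"
          then obtain x y where xy: "x \<in> T" "y \<in> T" "x \<noteq> y" "u = l x" "v = l y" by blast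
          then obtain j where j: "j < n" "\<epsilon> \<le> dist ((\<psi> ^^ j) x) ((\<psi> ^^ j) y)"
            using T(1) unfolding separated_points_def by blast
          have "(?\<Psi> ^^ j) u 0 = (\<psi> ^^ j) x" "(?\<Psi> ^^ j) v 0 = (\<psi> ^^ j) y"
            unfolding funpow_coordinatewise using lift xy TK(2) by auto
          then have "\<delta> \<le> (1 / 2) ^ to_nat (0::nat) * min (dist ((?\<Psi> ^^ j) u 0) ((?\<Psi> ^^ j) v 0)) 1"
            unfolding \<delta>_def using j(2) by (intro mult_left_mono) auto
          also have "\<dots> \<le> dist ((?\<Psi> ^^ j) u) ((?\<Psi> ^^ j) v)" by (rule dist_coordinate_le)
          finally show "\<exists>j<n. \<delta> \<le> dist ((?\<Psi> ^^ j) u) ((?\<Psi> ^^ j) v)" using j(1) by blast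
        qed
        then have "card (l ` T) \<le> max_separated ?X ?\<Psi> n \<delta>"
          by (rule card_le_max_separated[OF fin_X \<delta>])
        then show ?thesis using inj T(2) by (simp add: card_image)
      qed
      then show "\<exists>\<delta>>0. \<forall>n. max_separated K \<psi> n \<epsilon> \<le> max_separated ?X ?\<Psi> n \<delta>"
        using \<delta> by blast
    qed
  qed
qed

section \<open>Cutting the interval into pieces of injectivity\<close>

text \<open>Only intervals that avoid \<open>C\<close> are constrained, so nothing has to be decided about the piece to
  which a cut point belongs. A choice of half-open pieces would not survive composition with
  an order-reversing branch.\<close>

definition cut_set :: "(real \<Rightarrow> real) \<Rightarrow> real set \<Rightarrow> bool" where
  "cut_set \<phi> C \<longleftrightarrow>
     finite C \<and> (\<forall>J. is_interval J \<longrightarrow> J \<subseteq> {0..1} \<longrightarrow> J \<inter> C = {} \<longrightarrow> inj_on \<phi> J)"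

text \<open>Numbers the gaps of \<open>C\<close> by even and its points by odd numbers, from left to right.\<close>

definition label :: "real set \<Rightarrow> real \<Rightarrow> nat" where
  "label C x = card {c\<in>C. c < x} + card {c\<in>C. c \<le> x}"

lemma label_mono:
  assumes "finite C" "x \<le> y"
  shows "label C x \<le> label C y"
  unfolding label_def using assms by (intro add_mono card_mono) auto

lemma label_le:
  assumes "finite C"
  shows "label C x \<le> 2 * card C"
proof -
  have "card {c\<in>C. c < x} \<le> card C" "card {c\<in>C. c \<le> x} \<le> card C"
    using assms by (auto intro: card_mono)
  then show ?thesis unfolding label_def by simp
qed

lemma label_eq_imp_no_cut:
  assumes C: "finite C" and xy: "x < y" and eq: "label C x = label C y"
  shows "{x..y} \<inter> C = {}"
proof -
  have sub: "{c\<in>C. c < x} \<subseteq> {c\<in>C. c < y}" "{c\<in>C. c \<le> x} \<subseteq> {c\<in>C. c \<le> y}" using xy by auto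
  have fin: "finite {c\<in>C. c < y}" "finite {c\<in>C. c \<le> y}" using C by auto
  have "card {c\<in>C. c < x} \<le> card {c\<in>C. c < y}" "card {c\<in>C. c \<le> x} \<le> card {c\<in>C. c \<le> y}"
    using card_mono[OF fin(1) sub(1)] card_mono[OF fin(2) sub(2)] .
  then have "card {c\<in>C. c < x} = card {c\<in>C. c < y}" "card {c\<in>C. c \<le> x} = card {c\<in>C. c \<le> y}"
    using eq unfolding label_def by auto
  then have "{c\<in>C. c < x} = {c\<in>C. c < y}" "{c\<in>C. c \<le> x} = {c\<in>C. c \<le> y}"
    using card_subset_eq[OF fin(1) sub(1)] card_subset_eq[OF fin(2) sub(2)] by auto
  then have "(c < x \<longleftrightarrow> c < y) \<and> (c \<le> x \<longleftrightarrow> c \<le> y)" if "c \<in> C" for c using that by blast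
  then have "c < x \<or> y < c" if "c \<in> C" for c using that xy by (metis leD leI le_less)
  then show ?thesis by force
qed

lemma label_fibre_interval:
  assumes "finite C"
  shows "is_interval {x. label C x = i}"
  unfolding is_interval_1
proof (intro ballI allI impI)
  fix a b x assume ab: "a \<in> {x. label C x = i}" "b \<in> {x. label C x = i}" "a \<le> x \<and> x \<le> b"
  then have "label C a \<le> label C x" "label C x \<le> label C b"
    using label_mono[OF assms, of a x] label_mono[OF assms, of x b] by auto
  then show "x \<in> {x. label C x = i}" using ab(1,2) by simp
qed

text \<open>When \<open>\<delta>\<close> is at most the distance of any two cut points, moving by less than \<open>\<delta>\<close> passes at most
  one of them, so either of the two counts in the label changes by at most one.\<close>

lemma label_near:
  assumes "finite C"
  obtains \<delta> where "\<delta> > 0"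
    "\<And>x y. \<bar>x - y\<bar> < \<delta> \<Longrightarrow> label C y \<in> {label C x - 2..label C x + 2}"
proof -
  obtain \<delta> where \<delta>: "\<delta> > 0" "\<And>c d. c \<in> C \<Longrightarrow> d \<in> C \<Longrightarrow> c \<noteq> d \<Longrightarrow> \<delta> \<le> \<bar>c - d\<bar>"
  proof -
    (* The 1 keeps the set nonempty when C has fewer than two points. *)
    let ?D = "insert 1 ((\<lambda>(c, d). \<bar>c - d\<bar>) ` {p \<in> C \<times> C. fst p \<noteq> snd p})"
    have fin: "finite ?D" using assms by auto
    have "Min ?D > 0" using fin by (subst Min_gr_iff) auto
    moreover have "Min ?D \<le> \<bar>c - d\<bar>" if "c \<in> C" "d \<in> C" "c \<noteq> d" for c d
      using that fin by (intro Min_le) force+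
    ultimately show thesis using that by blast
  qed
  have step: "label C y \<le> label C x + 2" if xy: "x \<le> y" "y < x + \<delta>" for x y
  proof -
    have one: "card {c\<in>C. x \<le> c \<and> c < y} \<le> 1" "card {c\<in>C. x < c \<and> c \<le> y} \<le> 1"
      using \<delta> xy assms by (auto simp: card_le_Suc0_iff_eq) (smt (verit))+
    have "card {c\<in>C. c < y} \<le> card ({c\<in>C. c < x} \<union> {c\<in>C. x \<le> c \<and> c < y})"
      using assms by (intro card_mono) auto
    also have "\<dots> \<le> card {c\<in>C. c < x} + 1"
      using one(1) card_Un_le[of "{c\<in>C. c < x}" "{c\<in>C. x \<le> c \<and> c < y}"] by linarith
    finally have 1: "card {c\<in>C. c < y} \<le> card {c\<in>C. c < x} + 1" .
    have "card {c\<in>C. c \<le> y} \<le> card ({c\<in>C. c \<le> x} \<union> {c\<in>C. x < c \<and> c \<le> y})"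
      using assms by (intro card_mono) auto
    also have "\<dots> \<le> card {c\<in>C. c \<le> x} + 1"
      using one(2) card_Un_le[of "{c\<in>C. c \<le> x}" "{c\<in>C. x < c \<and> c \<le> y}"] by linarith
    finally show ?thesis using 1 unfolding label_def by linarith
  qed
  show thesis
  proof (rule that[OF \<delta>(1)])
    fix x y :: real assume "\<bar>x - y\<bar> < \<delta>"
    then have "label C y \<le> label C x + 2" "label C x \<le> label C y + 2"
      using step[of x y] step[of y x] label_mono[OF assms, of x y] label_mono[OF assms, of y x]
      by (cases "x \<le> y"; simp; linarith)+
    then show "label C y \<in> {label C x - 2..label C x + 2}" by simp
  qed
qed

lemma cut_set_inj_on_label:
  assumes \<phi>: "cut_set \<phi> C"
  shows "inj_on \<phi> {x\<in>{0..1}. label C x = i}"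
proof -
  have C: "finite C" using \<phi> by (simp add: cut_set_def)
  have "\<phi> x \<noteq> \<phi> y" if xy: "x \<in> {0..1}" "y \<in> {0..1}" "label C x = label C y" "x < y" for x y
  proof -
    have "{x..y} \<inter> C = {}" using label_eq_imp_no_cut[OF C xy(4,3)] .
    then have "inj_on \<phi> {x..y}" using \<phi> xy unfolding cut_set_def by (simp add: is_interval_cc)
    then show ?thesis using xy(4) by (auto dest: inj_onD)
  qed
  then show ?thesis by (intro linorder_inj_onI') auto
qed

text \<open>An interval that avoids all division points \<open>c i\<close> lies between two consecutive ones.\<close>

lemma piecewise_monotone_cut_set:
  assumes "piecewise_monotone \<phi>"
  shows "\<exists>C. cut_set \<phi> C"
proof -
  obtain k c where c: "c 0 = 0" "c k = 1"
    and mono: "\<And>i. i < k \<Longrightarrow> inj_on \<phi> {c i..c (Suc i)}"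
    using assms unfolding piecewise_monotone_def by blast
  have "inj_on \<phi> J" if J: "is_interval J" "J \<subseteq> {0..1}" "J \<inter> c ` {..k} = {}" for J
  proof (cases "J = {}")
    case False
    then obtain x where x: "x \<in> J" by blast
    have x01: "c 0 \<le> x" "x \<le> c k" using x J(2) c by auto
    have "\<exists>i<l. c i \<le> x \<and> x \<le> c (Suc i)" if "0 < l" "x \<le> c l" for l
      using that
    proof (induction l)
      case (Suc l)
      show ?case
      proof (cases "0 < l \<and> x \<le> c l")
        case True
        then show ?thesis using Suc.IH less_Suc_eq by blast
      next
        case False
        then show ?thesis using Suc.prems x01 by (intro exI[of _ l]) auto
      qed
    qed simp
    moreover have "0 < k" using c by (metis not_gr_zero zero_neq_one)
    ultimately obtain i where i: "i < k" "c i \<le> x" "x \<le> c (Suc i)" using x01(2) by blast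
    have cut: "c i \<notin> J" "c (Suc i) \<notin> J" using J(3) i(1) by auto
    have "c i \<le> y \<and> y \<le> c (Suc i)" if "y \<in> J" for y
      using J(1) x that i cut unfolding is_interval_1 by (meson linear)
    then show ?thesis using mono[OF i(1)] by (meson atLeastAtMost_iff inj_on_subset subsetI)
  qed simp
  then show ?thesis unfolding cut_set_def by (intro exI[of _ "c ` {..k}"]) simp
qed

text \<open>Two points with the same label and the same image coincide, so a preimage has no more points than
  there are labels.\<close>

lemma cut_set_finite_preimage:
  assumes \<phi>: "cut_set \<phi> C"
  shows "finite {x\<in>{0..1}. \<phi> x = y}"
proof -
  have C: "finite C" using \<phi> by (simp add: cut_set_def)
  have "inj_on (label C) {x\<in>{0..1}. \<phi> x = y}"
    using cut_set_inj_on_label[OF \<phi>] by (auto simp: inj_on_def)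
  moreover have "label C ` {x\<in>{0..1}. \<phi> x = y} \<subseteq> {..2 * card C}"
    using label_le[OF C] by auto
  ultimately show ?thesis by (meson finite_atMost finite_imageD finite_subset)
qed

text \<open>An interval \<open>J\<close> that avoids \<open>C\<close> and the preimage of \<open>C'\<close> is mapped by \<open>\<phi>\<close> injectively onto an
  interval that avoids \<open>C'\<close>.\<close>

lemma cut_set_comp:
  assumes \<phi>: "cut_set \<phi> C" "continuous_on {0..1} \<phi>" "\<phi> ` {0..1} \<subseteq> {0..1}"
    and \<psi>: "cut_set \<psi> C'"
  shows "cut_set (\<psi> \<circ> \<phi>) (C \<union> (\<Union>c\<in>C'. {x\<in>{0..1}. \<phi> x = c}))"
  unfolding cut_set_def
proof (intro conjI allI impI)
  show "finite (C \<union> (\<Union>c\<in>C'. {x\<in>{0..1}. \<phi> x = c}))"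
    using \<phi>(1) \<psi> cut_set_finite_preimage[OF \<phi>(1)] unfolding cut_set_def by blast
  fix J :: "real set"
  assume J: "is_interval J" "J \<subseteq> {0..1}" "J \<inter> (C \<union> (\<Union>c\<in>C'. {x\<in>{0..1}. \<phi> x = c})) = {}"
  have "is_interval (\<phi> ` J)"
    using J(1,2) \<phi>(2) by (meson connected_continuous_image continuous_on_subset is_interval_connected_1)
  moreover have "\<phi> ` J \<subseteq> {0..1}" "\<phi> ` J \<inter> C' = {}" using J(2,3) \<phi>(3) by blast+
  ultimately have "inj_on \<psi> (\<phi> ` J)" using \<psi> unfolding cut_set_def by blast
  moreover have "inj_on \<phi> J" using \<phi>(1) J unfolding cut_set_def by blast
  ultimately show "inj_on (\<psi> \<circ> \<phi>) J" by (intro comp_inj_on)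
qed

lemma cut_set_funpow:
  assumes "cut_set \<phi> C" "continuous_on {0..1} \<phi>" "\<phi> ` {0..1} \<subseteq> {0..1}"
  shows "\<exists>C. cut_set (\<phi> ^^ r) C"
proof (induction r)
  case 0
  have "cut_set (\<phi> ^^ 0) {}" by (simp add: cut_set_def)
  then show ?case by blast
next
  case (Suc r)
  then show ?case using cut_set_comp[OF assms] by (metis funpow_Suc_right)
qed

section \<open>Counting itineraries\<close>

text \<open>The restriction makes itineraries of length \<open>s\<close> elements of a finite product of finite sets.\<close>

definition itinerary :: "real set \<Rightarrow> (real \<Rightarrow> real) \<Rightarrow> nat \<Rightarrow> real \<Rightarrow> nat \<Rightarrow> nat" where
  "itinerary C D s x = restrict (\<lambda>j. label C ((D ^^ j) x)) {..<s}"

lemma finite_itineraries: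
  assumes "finite C"
  shows "finite (itinerary C D s ` X)"
proof (rule finite_subset)
  show "itinerary C D s ` X \<subseteq> (\<Pi>\<^sub>E j\<in>{..<s}. {..2 * card C})"
    unfolding itinerary_def using label_le[OF assms] by (intro image_subsetI restrict_PiE_iff[THEN iffD2]) simp
  show "finite (\<Pi>\<^sub>E j\<in>{..<s}. {..2 * card C})" by (intro finite_PiE) auto
qed

lemma inj_on_interval_imp_monotone:
  fixes g :: "real \<Rightarrow> real"
  assumes "is_interval J" "continuous_on J g" "inj_on g J"
  shows "mono_on J g \<or> antimono_on J g"
  using assms injective_eq_monotone_map[of J g]
  by (auto simp: monotone_on_def le_less)

lemma inj_on_preimage_interval:
  fixes g :: "real \<Rightarrow> real"
  assumes "is_interval J" "continuous_on J g" "inj_on g J" "is_interval K"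
  shows "is_interval {x\<in>J. g x \<in> K}"
  unfolding is_interval_1
proof (intro ballI allI impI)
  fix a b x assume ab: "a \<in> {x\<in>J. g x \<in> K}" "b \<in> {x\<in>J. g x \<in> K}" "a \<le> x \<and> x \<le> b"
  then have J: "a \<in> J" "b \<in> J" "x \<in> J" using assms(1) unfolding is_interval_1 by blast+
  have "mono_on J g \<or> antimono_on J g"
    using assms(1-3) by (rule inj_on_interval_imp_monotone)
  then have "(g a \<le> g x \<and> g x \<le> g b) \<or> (g b \<le> g x \<and> g x \<le> g a)"
    using J ab(3) by (auto simp: monotone_on_def)
  then show "x \<in> {x\<in>J. g x \<in> K}"
    using J ab assms(4) unfolding is_interval_1 by blast
qed

text \<open>Induction on the length: on the interval of points with a given itinerary of length \<open>s\<close> the iterate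
  \<open>D ^^ s\<close> is continuous and injective, hence monotone, so prescribing one more label cuts out a
  subinterval; on its image under \<open>D ^^ s\<close> the label is constant, so \<open>D\<close> is injective there.\<close>

lemma itinerary_fibre:
  assumes D: "cut_set D C" "continuous_on {0..1} D" "D ` {0..1} \<subseteq> {0..1}"
  shows "is_interval {x\<in>{0..1}. \<forall>j<s. label C ((D ^^ j) x) = w j} \<and>
    inj_on (D ^^ s) {x\<in>{0..1}. \<forall>j<s. label C ((D ^^ j) x) = w j}"
proof (induction s)
  case 0
  then show ?case using is_interval_cc[of "0::real" 1] by (simp add: atLeastAtMost_def atLeast_def atMost_def Collect_conj_eq)
next
  case (Suc s)
  have C: "finite C" using D(1) by (simp add: cut_set_def)
  define J where "J = {x\<in>{0..1}. \<forall>j<s. label C ((D ^^ j) x) = w j}"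
  have J: "is_interval J" "inj_on (D ^^ s) J" using Suc by (auto simp: J_def)
  have eq: "{x\<in>{0..1}. \<forall>j<Suc s. label C ((D ^^ j) x) = w j}
      = {x\<in>J. (D ^^ s) x \<in> {y. label C y = w s}}"
    unfolding J_def by (auto simp: less_Suc_eq)
  have "continuous_on J (D ^^ s)"
    using continuous_on_funpow[OF D(2,3)] by (rule continuous_on_subset) (auto simp: J_def)
  then have "is_interval {x\<in>J. (D ^^ s) x \<in> {y. label C y = w s}}"
    using J label_fibre_interval[OF C] by (intro inj_on_preimage_interval)
  moreover have "inj_on (D \<circ> D ^^ s) {x\<in>J. (D ^^ s) x \<in> {y. label C y = w s}}"
  proof (rule comp_inj_on)
    show "inj_on (D ^^ s) {x\<in>J. (D ^^ s) x \<in> {y. label C y = w s}}"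
      using J(2) by (rule inj_on_subset) auto
    show "inj_on D ((D ^^ s) ` {x\<in>J. (D ^^ s) x \<in> {y. label C y = w s}})"
      using cut_set_inj_on_label[OF D(1), of "w s"]
      by (rule inj_on_subset) (use funpow_in[OF D(3), of _ s] in \<open>auto simp: J_def\<close>)
  qed
  ultimately show ?case unfolding eq by (simp add: comp_def)
qed

text \<open>All \<open>A ^^ j\<close> with \<open>j < n\<close> are monotone on \<open>J\<close>, so after a change of sign of the decreasing ones their
  sum \<open>\<Phi>\<close> is increasing with values in an interval of length \<open>n\<close>. From one separated point to the
  next, some summand and hence \<open>\<Phi>\<close> grows by at least \<open>\<epsilon>\<close>.\<close>

lemma card_separated_le_on_piece:
  fixes A :: "real \<Rightarrow> real"
  assumes A: "continuous_on {0..1} A" "A ` {0..1} \<subseteq> {0..1}"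
    and J: "is_interval J" "J \<subseteq> {0..1}" "inj_on (A ^^ n) J"
    and T: "separated_points {0..1} A n \<epsilon> T" "T \<subseteq> J" and \<epsilon>: "\<epsilon> > 0"
  shows "real (card T) \<le> real n / \<epsilon> + 2"
proof -
  have mono: "mono_on J (A ^^ j) \<or> antimono_on J (A ^^ j)" if "j < n" for j
  proof -
    have "A ^^ n = A ^^ (n - j) \<circ> A ^^ j" using that by (simp flip: funpow_add)
    then have "inj_on (A ^^ j) J" using J(3) inj_on_imageI2 by metis
    moreover have "continuous_on J (A ^^ j)"
      using continuous_on_funpow[OF A] J(2) by (rule continuous_on_subset)
    ultimately show ?thesis using inj_on_interval_imp_monotone[OF J(1)] by blast
  qed
  define \<sigma> :: "nat \<Rightarrow> real" where "\<sigma> j = (if mono_on J (A ^^ j) then 1 else -1)" for j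
  define \<Phi> where "\<Phi> x = (\<Sum>j<n. \<sigma> j * (A ^^ j) x)" for x
  (* A decreasing iterate contributes values in {-1..0}, an increasing one values in {0..1}. *)
  define b where "b = (\<Sum>j<n. min (\<sigma> j) 0)"
  have gap: "\<Phi> y - \<Phi> x = (\<Sum>j<n. \<bar>(A ^^ j) y - (A ^^ j) x\<bar>)" if "x \<in> J" "y \<in> J" "x \<le> y" for x y
  proof -
    have "\<sigma> j * (A ^^ j) y - \<sigma> j * (A ^^ j) x = \<bar>(A ^^ j) y - (A ^^ j) x\<bar>" if "j < n" for j
    proof (cases "mono_on J (A ^^ j)")
      case True
      then have "(A ^^ j) x \<le> (A ^^ j) y"
        using \<open>x \<in> J\<close> \<open>y \<in> J\<close> \<open>x \<le> y\<close> by (simp add: monotone_on_def)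
      then show ?thesis using True by (simp add: \<sigma>_def)
    next
      case False
      then have "antimono_on J (A ^^ j)" using mono[OF that] by blast
      then have "(A ^^ j) y \<le> (A ^^ j) x"
        using \<open>x \<in> J\<close> \<open>y \<in> J\<close> \<open>x \<le> y\<close> by (simp add: monotone_on_def)
      then show ?thesis using False by (simp add: \<sigma>_def)
    qed
    then show ?thesis unfolding \<Phi>_def by (simp flip: sum_subtractf)
  qed
  have range: "b \<le> \<Phi> x \<and> \<Phi> x \<le> b + real n" if "x \<in> J" for x
  proof -
    have x: "0 \<le> (A ^^ j) x" "(A ^^ j) x \<le> 1" for j
      using funpow_in[OF A(2), of x j] that J(2) by auto
    have "b \<le> \<Phi> x" unfolding b_def \<Phi>_def \<sigma>_def using x by (intro sum_mono) auto
    moreover have "\<Phi> x \<le> (\<Sum>j<n. min (\<sigma> j) 0 + 1)"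
      unfolding \<Phi>_def \<sigma>_def using x by (intro sum_mono) auto
    ultimately show ?thesis unfolding b_def by (simp add: sum.distrib)
  qed
  define q where "q x = \<lfloor>(\<Phi> x - b) / \<epsilon>\<rfloor>" for x
  have fin: "finite T" using T(1) by (simp add: separated_points_def)
  have "q x \<noteq> q y" if xy: "x \<in> T" "y \<in> T" "x < y" for x y
  proof -
    obtain j where j: "j < n" "\<epsilon> \<le> \<bar>(A ^^ j) y - (A ^^ j) x\<bar>"
      using T(1) xy unfolding separated_points_def dist_real_def
      by (metis abs_minus_commute less_irrefl)
    have "\<epsilon> \<le> (\<Sum>j<n. \<bar>(A ^^ j) y - (A ^^ j) x\<bar>)"
      using j member_le_sum[of j "{..<n}" "\<lambda>j. \<bar>(A ^^ j) y - (A ^^ j) x\<bar>"] by simp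
    moreover have "x \<in> J" "y \<in> J" using xy T(2) by auto
    ultimately have "\<Phi> x + \<epsilon> \<le> \<Phi> y" using gap[of x y] xy(3) by linarith
    then have "(\<Phi> x - b + \<epsilon>) / \<epsilon> \<le> (\<Phi> y - b) / \<epsilon>" using \<epsilon> by (intro divide_right_mono) auto
    then have "(\<Phi> x - b) / \<epsilon> + 1 \<le> (\<Phi> y - b) / \<epsilon>" using \<epsilon> by (simp add: add_divide_distrib)
    then show ?thesis unfolding q_def by linarith
  qed
  then have "inj_on q T" by (intro linorder_inj_onI') auto
  moreover have "q ` T \<subseteq> {0..\<lfloor>real n / \<epsilon>\<rfloor>}"
  proof (rule image_subsetI)
    fix x assume "x \<in> T"
    then have "0 \<le> \<Phi> x - b" "\<Phi> x - b \<le> real n" using range[of x] T(2) by auto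
    then show "q x \<in> {0..\<lfloor>real n / \<epsilon>\<rfloor>}"
      unfolding q_def using \<epsilon> by (auto intro!: floor_mono divide_right_mono)
  qed
  ultimately have "card T \<le> card {0..\<lfloor>real n / \<epsilon>\<rfloor>}" by (intro card_inj_on_le) auto
  moreover have "0 \<le> \<lfloor>real n / \<epsilon>\<rfloor>" using \<epsilon> by simp
  ultimately have "int (card T) \<le> \<lfloor>real n / \<epsilon>\<rfloor> + 1"
    unfolding card_atLeastAtMost_int by linarith
  then show ?thesis by linarith
qed

text \<open>Points of the same itinerary form an interval on which \<open>D ^^ s\<close>, and therefore \<open>A ^^ n\<close>, is
  injective, so each itinerary accounts for at most \<open>n / \<epsilon> + 2\<close> separated points.\<close>

lemma max_separated_le_itineraries:
  fixes A :: "real \<Rightarrow> real"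
  assumes A: "continuous_on {0..1} A" "A ` {0..1} \<subseteq> {0..1}"
    and D: "cut_set D C" "continuous_on {0..1} D" "D ` {0..1} \<subseteq> {0..1}"
    and inj: "\<And>J. J \<subseteq> {0..1} \<Longrightarrow> inj_on (D ^^ s) J \<Longrightarrow> inj_on (A ^^ n) J"
    and \<epsilon>: "\<epsilon> > 0"
  shows "real (max_separated {0..1} A n \<epsilon>)
    \<le> real (card (itinerary C D s ` {0..1})) * (real n / \<epsilon> + 2)"
proof -
  let ?W = "itinerary C D s ` {0..1}"
  have C: "finite C" using D(1) by (simp add: cut_set_def)
  have fin: "finitely_separated {0..1} A" using A by (intro finitely_separated_compact) auto
  obtain T where T: "separated_points {0..1} A n \<epsilon> T" "card T = max_separated {0..1} A n \<epsilon>"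
    using max_separated_attained[OF fin \<epsilon>] .
  have T': "finite T" "T \<subseteq> {0..1}" using T(1) by (auto simp: separated_points_def)
  have piece: "real (card {x\<in>T. itinerary C D s x = w}) \<le> real n / \<epsilon> + 2" for w
  proof -
    let ?J = "{x\<in>{0..1}. \<forall>j<s. label C ((D ^^ j) x) = w j}"
    have J: "is_interval ?J" "inj_on (D ^^ s) ?J" using itinerary_fibre[OF D] by auto
    have sub: "{x\<in>T. itinerary C D s x = w} \<subseteq> ?J"
      using T'(2) unfolding itinerary_def by auto
    have "separated_points {0..1} A n \<epsilon> {x\<in>T. itinerary C D s x = w}"
      using T(1) unfolding separated_points_def by auto
    then show ?thesis
      using card_separated_le_on_piece[OF A J(1) _ inj[OF _ J(2)] _ sub \<epsilon>] by blast
  qed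
  have "T = (\<Union>w\<in>?W. {x\<in>T. itinerary C D s x = w})" using T'(2) by auto
  then have "card T = card (\<Union>w\<in>?W. {x\<in>T. itinerary C D s x = w})" by (rule arg_cong)
  also have "\<dots> \<le> (\<Sum>w\<in>?W. card {x\<in>T. itinerary C D s x = w})"
    by (rule card_UN_le[OF finite_itineraries[OF C]])
  finally have "card T \<le> (\<Sum>w\<in>?W. card {x\<in>T. itinerary C D s x = w})" .
  then have "real (card T) \<le> (\<Sum>w\<in>?W. real (card {x\<in>T. itinerary C D s x = w}))"
    unfolding of_nat_sum[symmetric] of_nat_le_iff .
  also have "\<dots> \<le> (\<Sum>w\<in>?W. real n / \<epsilon> + 2)" using piece by (intro sum_mono)
  finally show ?thesis using T(2) by simp
qed

text \<open>Each orbit stays close to the orbit of some member of a largest separated set. Its itinerary then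
  differs from that of this member by at most two in each of the \<open>s\<close> places, which leaves \<open>5\<close>
  possible labels in each.\<close>

lemma card_itineraries_le:
  assumes D: "continuous_on {0..1} D" "D ` {0..1} \<subseteq> {0..1}" and C: "finite C"
  obtains \<delta> where "\<delta> > 0"
    "\<And>s. card (itinerary C D s ` {0..1}) \<le> 5 ^ s * max_separated {0..1} D s \<delta>"
proof -
  obtain \<delta> where \<delta>: "\<delta> > 0"
    "\<And>x y. \<bar>x - y\<bar> < \<delta> \<Longrightarrow> label C y \<in> {label C x - 2..label C x + 2}"
    using label_near[OF C] by blast
  have fin: "finitely_separated {0..1} D" using D by (intro finitely_separated_compact) auto
  have "card (itinerary C D s ` {0..1}) \<le> 5 ^ s * max_separated {0..1} D s \<delta>" for s
  proof -
    obtain T where T: "separated_points {0..1} D s \<delta> T" "card T = max_separated {0..1} D s \<delta>"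
      and span: "\<And>x. x \<in> {0..1} \<Longrightarrow> \<exists>y\<in>T. \<forall>j<s. dist ((D ^^ j) x) ((D ^^ j) y) < \<delta>"
      using max_separated_spanning[OF fin \<delta>(1)] by blast
    have T': "finite T" using T(1) by (simp add: separated_points_def)
    define N where "N y = (\<Pi>\<^sub>E j\<in>{..<s}. {label C ((D ^^ j) y) - 2..label C ((D ^^ j) y) + 2})" for y
    have N: "finite (N y)" "card (N y) \<le> 5 ^ s" for y
    proof -
      show "finite (N y)" unfolding N_def by (intro finite_PiE) auto
      have "card (N y) \<le> (\<Prod>j<s. 5)"
        unfolding N_def by (subst card_PiE) (simp, intro prod_mono, simp)
      then show "card (N y) \<le> 5 ^ s" by simp
    qed
    have "itinerary C D s ` {0..1} \<subseteq> (\<Union>y\<in>T. N y)"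
    proof (rule image_subsetI)
      fix x :: real assume "x \<in> {0..1}"
      then obtain y where y: "y \<in> T" "\<And>j. j < s \<Longrightarrow> dist ((D ^^ j) x) ((D ^^ j) y) < \<delta>"
        using span by blast
      have "itinerary C D s x \<in> N y"
        unfolding itinerary_def N_def
      proof (rule restrict_PiE_iff[THEN iffD2], rule ballI)
        fix j assume "j \<in> {..<s}"
        then show "label C ((D ^^ j) x) \<in> {label C ((D ^^ j) y) - 2..label C ((D ^^ j) y) + 2}"
          using \<delta>(2)[of "(D ^^ j) y" "(D ^^ j) x"] y(2)[of j]
          by (simp add: dist_real_def abs_minus_commute)
      qed
      then show "itinerary C D s x \<in> (\<Union>y\<in>T. N y)" using y(1) by blast
    qed
    then have "card (itinerary C D s ` {0..1}) \<le> card (\<Union>y\<in>T. N y)"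
      using N(1) T' by (intro card_mono) auto
    also have "\<dots> \<le> (\<Sum>y\<in>T. card (N y))" using card_UN_le[OF T'] .
    also have "\<dots> \<le> (\<Sum>y\<in>T. 5 ^ s)" using N(2) by (intro sum_mono)
    also have "\<dots> = 5 ^ s * max_separated {0..1} D s \<delta>" using T(2) by simp
    finally show ?thesis .
  qed
  then show thesis using that \<delta>(1) by blast
qed

lemma max_separated_funpow_le:
  assumes "finitely_separated X B" "finitely_separated X (B ^^ r)" "0 < r" "0 < \<delta>"
  shows "max_separated X (B ^^ r) s \<delta> \<le> max_separated X B (r * s) \<delta>"
proof -
  obtain T where T: "separated_points X (B ^^ r) s \<delta> T" "card T = max_separated X (B ^^ r) s \<delta>"
    using max_separated_attained[OF assms(2,4)] .
  have "separated_points X B (r * s) \<delta> T"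
    unfolding separated_points_def
  proof (intro conjI ballI impI)
    fix x y assume "x \<in> T" "y \<in> T" "x \<noteq> y"
    then obtain j where "j < s" "\<delta> \<le> dist ((B ^^ (r * j)) x) ((B ^^ (r * j)) y)"
      using T(1) unfolding separated_points_def funpow_mult by blast
    then show "\<exists>j<r * s. \<delta> \<le> dist ((B ^^ j) x) ((B ^^ j) y)"
      using assms(3) by (intro exI[of _ "r * j"]) simp
  qed (use T(1) in \<open>auto simp: separated_points_def\<close>)
  from card_le_max_separated[OF assms(1,4) this] show ?thesis using T(2) by simp
qed

section \<open>Comparing the entropies of interval maps\<close>

text \<open>The two sides of the passage between bounds on a limit superior and bounds that hold for all \<open>n\<close>.\<close>

lemma growth_rate_le:
  fixes s :: "nat \<Rightarrow> nat" and \<epsilon> K c :: real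
  assumes \<epsilon>: "\<epsilon> > 0" and s: "\<And>n. ln (real (s n)) \<le> ln (real n / \<epsilon> + 2) + K + c * real n"
  shows "limsup (\<lambda>n. ereal (1 / real n * ln (real (s n)))) \<le> ereal c"
proof -
  let ?u = "\<lambda>n. 1 / real n * (ln (real n / \<epsilon> + 2) + K + c * real n)"
  have "?u \<longlonglongrightarrow> c" using \<epsilon> by real_asymp
  then have "limsup (\<lambda>n. ereal (?u n)) = ereal c" by (intro lim_imp_Limsup) simp_all
  moreover have "limsup (\<lambda>n. ereal (1 / real n * ln (real (s n)))) \<le> limsup (\<lambda>n. ereal (?u n))"
    using s by (intro Limsup_mono always_eventually allI) (simp add: divide_right_mono)
  ultimately show ?thesis by simp
qed

lemma growth_rate_lessD:
  fixes s :: "nat \<Rightarrow> nat" and c :: real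
  assumes s: "\<And>n. 1 \<le> s n" and c: "limsup (\<lambda>n. ereal (1 / real n * ln (real (s n)))) < ereal c"
  shows "\<exists>K. \<forall>n. ln (real (s n)) \<le> c * real n + K"
proof -
  have "eventually (\<lambda>n. ereal (1 / real n * ln (real (s n))) < ereal c) sequentially"
    using Limsup_lessD[OF c] .
  then obtain N where N: "\<And>n. n \<ge> N \<Longrightarrow> 1 / real n * ln (real (s n)) < c"
    unfolding eventually_sequentially by auto
  define K where "K = (\<Sum>n\<le>N. \<bar>ln (real (s n)) - c * real n\<bar>)"
  have "ln (real (s n)) \<le> c * real n + K" for n
  proof (cases "n \<le> N")
    case True
    then have "\<bar>ln (real (s n)) - c * real n\<bar> \<le> K"
      unfolding K_def by (intro member_le_sum) auto
    then show ?thesis by linarith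
  next
    case False
    then have "ln (real (s n)) < c * real n" using N[of n] by (simp add: field_simps)
    moreover have "0 \<le> K" unfolding K_def by (intro sum_nonneg) simp
    ultimately show ?thesis by linarith
  qed
  then show ?thesis by blast
qed

text \<open>The pieces of \<open>B ^^ r\<close> after \<open>s\<close> steps are intervals of injectivity of \<open>B ^^ (r * s)\<close>. The value of
  \<open>s\<close> is chosen so that \<open>n * p \<le> r * s * t\<close>, hence \<open>A ^^ n\<close> is injective on them.\<close>

lemma max_separated_le_comparison:
  fixes A B :: "real \<Rightarrow> real" and p t r :: nat
  assumes A: "continuous_on {0..1} A" "A ` {0..1} \<subseteq> {0..1}"
    and B: "continuous_on {0..1} B" "B ` {0..1} \<subseteq> {0..1}" "cut_set (B ^^ r) C"
    and rt: "0 < r" "0 < t"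
    and inj: "\<And>J n q. J \<subseteq> {0..1} \<Longrightarrow> n * p \<le> q * t \<Longrightarrow> inj_on (B ^^ q) J \<Longrightarrow> inj_on (A ^^ n) J"
  shows "\<exists>\<delta>>0. \<forall>n s. \<forall>\<epsilon>>0. s = n * p div (r * t) + 1 \<longrightarrow>
    real (max_separated {0..1} A n \<epsilon>)
      \<le> 5 ^ s * real (max_separated {0..1} B (r * s) \<delta>) * (real n / \<epsilon> + 2)"
proof -
  let ?D = "B ^^ r"
  have D: "continuous_on {0..1} ?D" "?D ` {0..1} \<subseteq> {0..1}"
    using continuous_on_funpow[OF B(1,2)] funpow_in[OF B(2)] by auto
  have C: "finite C" using B(3) by (simp add: cut_set_def)
  have fin: "finitely_separated {0..1} B" "finitely_separated {0..1} ?D"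
    using B D by (auto intro: finitely_separated_compact)
  obtain \<delta> where \<delta>: "\<delta> > 0"
    "\<And>s. card (itinerary C ?D s ` {0..1}) \<le> 5 ^ s * max_separated {0..1} ?D s \<delta>"
    using card_itineraries_le[OF D C] by blast
  have "real (max_separated {0..1} A n \<epsilon>)
      \<le> 5 ^ s * real (max_separated {0..1} B (r * s) \<delta>) * (real n / \<epsilon> + 2)"
    if \<epsilon>: "\<epsilon> > 0" and s: "s = n * p div (r * t) + 1" for n s and \<epsilon> :: real
  proof -
    have "n * p \<le> (r * s) * t"
      using dividend_less_div_times[of "r * t" "n * p"] rt s by (simp add: algebra_simps)
    then have "inj_on (A ^^ n) J" if "J \<subseteq> {0..1}" "inj_on (?D ^^ s) J" for J
      using that inj unfolding funpow_mult by blast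
    then have "real (max_separated {0..1} A n \<epsilon>)
        \<le> real (card (itinerary C ?D s ` {0..1})) * (real n / \<epsilon> + 2)"
      using \<epsilon> by (intro max_separated_le_itineraries[OF A B(3) D])
    also have "card (itinerary C ?D s ` {0..1}) \<le> 5 ^ s * max_separated {0..1} B (r * s) \<delta>"
      using \<delta>(2)[of s] max_separated_funpow_le[OF fin rt(1) \<delta>(1), of s]
      by (meson mult_le_mono2 order_trans)
    then have "real (card (itinerary C ?D s ` {0..1})) * (real n / \<epsilon> + 2)
        \<le> real (5 ^ s * max_separated {0..1} B (r * s) \<delta>) * (real n / \<epsilon> + 2)"
      using \<epsilon> by (intro mult_right_mono) (simp_all only: of_nat_le_iff, simp)
    finally show ?thesis by simp
  qed
  then show ?thesis using \<delta>(1) by blast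
qed

text \<open>Here \<open>p / t\<close> is the number of steps of \<open>B\<close> that are needed, per step of \<open>A\<close>, for the injectivity of
  \<open>B\<close> to imply that of \<open>A\<close>. For fixed \<open>r\<close> the comparison gives the inequality with the additional
  terms of \<open>bound r\<close>: the term \<open>ln 5 / r\<close> comes from the \<open>5\<close> labels that a close orbit can have
  at each step of \<open>B ^^ r\<close>, and \<open>1 / r\<close> is the margin by which \<open>Ent B\<close> is exceeded in order to
  have a bound for all \<open>n\<close>. Both vanish as \<open>r\<close> grows.\<close>

lemma Ent_le_of_injectivity:
  fixes A B :: "real \<Rightarrow> real" and p t :: nat
  assumes A: "continuous_on {0..1} A" "A ` {0..1} \<subseteq> {0..1}"
    and B: "continuous_on {0..1} B" "B ` {0..1} \<subseteq> {0..1}" "\<And>r. \<exists>C. cut_set (B ^^ r) C"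
    and t: "0 < t"
    and inj: "\<And>J n q. J \<subseteq> {0..1} \<Longrightarrow> n * p \<le> q * t \<Longrightarrow> inj_on (B ^^ q) J \<Longrightarrow> inj_on (A ^^ n) J"
  shows "Ent {0..1} A \<le> ereal (real p / real t) * Ent {0..1} B"
proof -
  have fin: "finitely_separated {0..1} A" "finitely_separated {0..1} B"
    using A B(1,2) by (auto intro: finitely_separated_compact)
  have ne: "{0..1::real} \<noteq> {}" by simp
  consider "p = 0" | "0 < p" "Ent {0..1} B = \<infinity>" | E where "Ent {0..1} B = ereal E"
    using Ent_nonneg[OF fin(2) ne] by (cases "Ent {0..1} B") auto
  then show ?thesis
  proof cases
    case 1
    (* Then every iterate of A is injective on the whole interval. This case also covers an infinite
       entropy of B, where the product on the right is 0. *)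
    have "sep_growth {0..1} A \<epsilon> \<le> 0" if \<epsilon>: "\<epsilon> > 0" for \<epsilon>
    proof -
      have "ln (real (max_separated {0..1} A n \<epsilon>)) \<le> ln (real n / \<epsilon> + 2) + 0 + 0 * real n" for n
      proof -
        obtain T where T: "separated_points {0..1} A n \<epsilon> T" "card T = max_separated {0..1} A n \<epsilon>"
          using max_separated_attained[OF fin(1) \<epsilon>] .
        have "inj_on (A ^^ n) {0..1}" using 1 inj[of "{0..1}" n 0] by simp
        then have "real (card T) \<le> real n / \<epsilon> + 2"
          using T(1) \<epsilon> by (intro card_separated_le_on_piece[OF A is_interval_cc])
            (auto simp: separated_points_def)
        moreover have "1 \<le> max_separated {0..1} A n \<epsilon>" by (rule max_separated_ge_1[OF fin(1) \<epsilon> ne])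
        ultimately show ?thesis using T(2) by simp
      qed
      from growth_rate_le[OF \<epsilon> this] show ?thesis unfolding sep_growth_def zero_ereal_def .
    qed
    then have "Ent {0..1} A \<le> 0" by (intro Ent_leI[OF fin(1) ne])
    then show ?thesis using 1 by (simp add: zero_ereal_def[symmetric])
  next
    case 2
    then show ?thesis using t by simp
  next
    case 3
    define bound :: "nat \<Rightarrow> real"
      where "bound r = real p / real t * (E + inverse (real r) + ln 5 * inverse (real r))" for r
    have "bound \<longlonglongrightarrow> real p / real t * (E + 0 + ln 5 * 0)"
      unfolding bound_def by (intro tendsto_intros lim_inverse_n)
    then have lim: "(\<lambda>r. ereal (bound r)) \<longlonglongrightarrow> ereal (real p / real t * E)" by simp
    have "Ent {0..1} A \<le> ereal (bound r)" if r: "r \<ge> 1" for r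
    proof (rule Ent_leI[OF fin(1) ne])
      fix \<epsilon> :: real assume \<epsilon>: "\<epsilon> > 0"
      have r': "0 < r" using r by simp
      obtain C where C: "cut_set (B ^^ r) C" using B(3) by blast
      have "\<exists>\<delta>>0. \<forall>n s. \<forall>\<epsilon>>0. s = n * p div (r * t) + 1 \<longrightarrow>
          real (max_separated {0..1} A n \<epsilon>)
            \<le> 5 ^ s * real (max_separated {0..1} B (r * s) \<delta>) * (real n / \<epsilon> + 2)"
        by (rule max_separated_le_comparison[OF A B(1,2) C r' t]) (rule inj)
      then obtain \<delta> where \<delta>: "\<delta> > 0"
        "\<And>n \<epsilon> s. \<epsilon> > 0 \<Longrightarrow> s = n * p div (r * t) + 1 \<Longrightarrow>
          real (max_separated {0..1} A n \<epsilon>)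
            \<le> 5 ^ s * real (max_separated {0..1} B (r * s) \<delta>) * (real n / \<epsilon> + 2)"
        by blast
      define E' where "E' = E + inverse (real r)"
      have B1: "1 \<le> max_separated {0..1} B n \<delta>" for n by (rule max_separated_ge_1[OF fin(2) \<delta>(1) ne])
      have A1: "1 \<le> max_separated {0..1} A n \<epsilon>" for n by (rule max_separated_ge_1[OF fin(1) \<epsilon> ne])
      have "sep_growth {0..1} B \<delta> \<le> ereal E" using sep_growth_le_Ent[OF fin(2) ne \<delta>(1)] 3 by simp
      also have "\<dots> < ereal E'" unfolding E'_def using r by simp
      finally obtain K where K: "\<And>n. ln (real (max_separated {0..1} B n \<delta>)) \<le> E' * real n + K"
        using growth_rate_lessD[of "\<lambda>n. max_separated {0..1} B n \<delta>" E'] B1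
        unfolding sep_growth_def by blast
      have E0: "0 \<le> E'"
        using Ent_nonneg[OF fin(2) ne] 3 unfolding E'_def by simp
      define c where "c = ln 5 + E' * real r"
      have c0: "0 \<le> c" unfolding c_def using E0 by simp
      have "ln (real (max_separated {0..1} A n \<epsilon>))
          \<le> ln (real n / \<epsilon> + 2) + (c + K) + bound r * real n" for n
      proof -
        define s where "s = n * p div (r * t) + 1"
        have pos: "0 < real n / \<epsilon> + 2" using \<epsilon> by (simp add: add_nonneg_pos)
        have "real (max_separated {0..1} A n \<epsilon>)
            \<le> 5 ^ s * real (max_separated {0..1} B (r * s) \<delta>) * (real n / \<epsilon> + 2)"
          using \<delta>(2)[OF \<epsilon>] s_def by blast
        then have "ln (real (max_separated {0..1} A n \<epsilon>))
            \<le> ln (5 ^ s * real (max_separated {0..1} B (r * s) \<delta>) * (real n / \<epsilon> + 2))"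
          using A1[of n] by (intro ln_mono) auto
        also have "\<dots> = real s * ln 5 + ln (real (max_separated {0..1} B (r * s) \<delta>))
            + ln (real n / \<epsilon> + 2)"
          using B1[of "r * s"] pos by (simp add: ln_mult ln_realpow)
        also have "\<dots> \<le> real s * ln 5 + (E' * real (r * s) + K) + ln (real n / \<epsilon> + 2)"
          using K[of "r * s"] by simp
        also have "\<dots> = c * real s + K + ln (real n / \<epsilon> + 2)"
          unfolding c_def by (simp add: algebra_simps)
        finally have 1: "ln (real (max_separated {0..1} A n \<epsilon>)) \<le> c * real s + K + ln (real n / \<epsilon> + 2)" .
        have "real (n * p div (r * t)) \<le> real (n * p) / real (r * t)" by (rule of_nat_div_le_of_nat)
        then have "c * real s \<le> c * (real (n * p) / real (r * t) + 1)"
          unfolding s_def using c0 by (intro mult_left_mono) simp_all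
        also have "\<dots> = c + bound r * real n"
          unfolding bound_def c_def E'_def using r' t by (simp add: field_simps)
        finally show ?thesis using 1 by linarith
      qed
      from growth_rate_le[OF \<epsilon> this] show "sep_growth {0..1} A \<epsilon> \<le> ereal (bound r)"
        unfolding sep_growth_def .
    qed
    then have "Ent {0..1} A \<le> ereal (real p / real t * E)"
      by (intro LIMSEQ_le_const[OF lim]) blast
    then show ?thesis using 3 by simp
  qed
qed

text \<open>Since \<open>H\<close> is injective, \<open>(H \<circ> \<phi> ^^ k) ^^ q\<close> and \<open>\<phi> ^^ (k * q)\<close> are injective on the same sets.
  Comparison in one direction gives \<open>\<le>\<close>, with ratio \<open>k / 1\<close>, and in the other \<open>\<ge>\<close>, with ratio
  \<open>1 / k\<close>.\<close>

lemma Ent_injective_comp_power: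
  fixes \<phi> H :: "real \<Rightarrow> real"
  assumes \<phi>: "continuous_on {0..1} \<phi>" "\<phi> ` {0..1} \<subseteq> {0..1}" "cut_set \<phi> C"
    and H: "continuous_on {0..1} H" "H ` {0..1} \<subseteq> {0..1}" "inj_on H {0..1}"
    and comm: "\<And>x. x \<in> {0..1} \<Longrightarrow> \<phi> (H x) = H (\<phi> x)"
  shows "Ent {0..1} (H \<circ> \<phi> ^^ k) = ereal (real k) * Ent {0..1} \<phi>"
proof -
  let ?I = "{0..1::real}" and ?\<psi> = "H \<circ> \<phi> ^^ k"
  have pow_maps: "(\<phi> ^^ j) ` ?I \<subseteq> ?I" "(H ^^ j) ` ?I \<subseteq> ?I" for j
    using funpow_in[OF \<phi>(2)] funpow_in[OF H(2)] by auto
  have \<psi>: "continuous_on ?I ?\<psi>" "?\<psi> ` ?I \<subseteq> ?I"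
  proof -
    show "continuous_on ?I ?\<psi>"
      using continuous_on_funpow[OF \<phi>(1,2)] continuous_on_subset[OF H(1) pow_maps(1)]
      by (rule continuous_on_compose)
    show "?\<psi> ` ?I \<subseteq> ?I" using H(2) pow_maps(1)[of k] unfolding image_comp[symmetric] by blast
  qed
  have iterate: "(?\<psi> ^^ j) x = (H ^^ j) ((\<phi> ^^ (k * j)) x)" if "x \<in> ?I" for j x
    using funpow_comp_on[OF pow_maps(1) H(2) _ that, of k j]
      funpow_commute_on[OF \<phi>(2) comm H(2)] by (simp add: funpow_mult)
  have inj_iff: "inj_on (?\<psi> ^^ q) J \<longleftrightarrow> inj_on (\<phi> ^^ (k * q)) J" if J: "J \<subseteq> ?I" for q J
  proof -
    have "inj_on (?\<psi> ^^ q) J \<longleftrightarrow> inj_on (H ^^ q \<circ> \<phi> ^^ (k * q)) J"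
      using J iterate by (intro inj_on_cong) auto
    moreover have "inj_on (H ^^ q) ((\<phi> ^^ (k * q)) ` J)"
      using inj_on_funpow_on[OF H(2,3), of q] pow_maps(1)[of "k * q"] J by (blast intro: inj_on_subset)
    ultimately show ?thesis using comp_inj_on inj_on_imageI2 by metis
  qed
  have inj_less: "inj_on (\<phi> ^^ i) J" if "i \<le> j" "inj_on (\<phi> ^^ j) J" for i j J
  proof -
    have "\<phi> ^^ j = \<phi> ^^ (j - i) \<circ> \<phi> ^^ i" using that(1) by (simp flip: funpow_add)
    then show ?thesis using that(2) inj_on_imageI2 by metis
  qed
  have cuts: "\<exists>C. cut_set (\<phi> ^^ r) C" for r using cut_set_funpow[OF \<phi>(3,1,2)] .
  then have \<psi>_cuts: "\<exists>C. cut_set (?\<psi> ^^ r) C" for r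
    using inj_iff unfolding cut_set_def by metis
  show ?thesis
  proof (rule antisym)
    have "Ent ?I ?\<psi> \<le> ereal (real k / real 1) * Ent ?I \<phi>"
    proof (rule Ent_le_of_injectivity[OF \<psi> \<phi>(1,2) cuts])
      fix J n q assume "J \<subseteq> ?I" "n * k \<le> q * 1" "inj_on (\<phi> ^^ q) J"
      then show "inj_on (?\<psi> ^^ n) J" using inj_iff inj_less by (simp add: mult.commute)
    qed simp
    then show "Ent ?I ?\<psi> \<le> ereal (real k) * Ent ?I \<phi>" by simp
  next
    show "ereal (real k) * Ent ?I \<phi> \<le> Ent ?I ?\<psi>"
    proof (cases "k = 0")
      case True
      then show ?thesis
        using Ent_nonneg[OF finitely_separated_compact[OF _ \<psi>]] by (simp add: zero_ereal_def[symmetric])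
    next
      case False
      have "Ent ?I \<phi> \<le> ereal (real 1 / real k) * Ent ?I ?\<psi>"
      proof (rule Ent_le_of_injectivity[OF \<phi>(1,2) \<psi> \<psi>_cuts])
        fix J n q assume "J \<subseteq> ?I" "n * 1 \<le> q * k" "inj_on (?\<psi> ^^ q) J"
        then show "inj_on (\<phi> ^^ n) J" using inj_iff inj_less by (simp add: mult.commute)
      qed (use False in simp)
      then have "ereal (real k) * Ent ?I \<phi> \<le> ereal (real k) * (ereal (1 / real k) * Ent ?I ?\<psi>)"
        by (intro ereal_mult_left_mono) simp_all
      also have "\<dots> = Ent ?I ?\<psi>"
        using False by (simp add: mult.assoc[symmetric] one_ereal_def[symmetric])
      finally show ?thesis .
    qed
  qed
qed

section \<open>The shifted map on the inverse limit\<close>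

text \<open>As \<open>g = \<psi> \<circ> f\<close> on \<open>K\<close> and \<open>f (x (Suc i)) = x i\<close>, the map \<open>G\<close> is the coordinatewise action of \<open>\<psi>\<close>.\<close>

lemma Ent_shifted_forward:
  fixes K :: "'a::metric_space set"
  assumes K: "compact K" "K \<noteq> {}" and f: "continuous_on K f" "f ` K = K"
    and \<psi>: "continuous_on K \<psi>" "\<psi> ` K \<subseteq> K"
    and factor: "\<And>x. x \<in> K \<Longrightarrow> \<psi> (f x) = g x" "\<And>x. x \<in> K \<Longrightarrow> f (\<psi> x) = g x"
    and G: "\<And>x. x \<in> inverse_limit K f \<Longrightarrow> G x = (\<lambda>i. g (x (Suc i)))"
  shows "Ent (inverse_limit K f) G = Ent K \<psi>"
proof -
  let ?X = "inverse_limit K f"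
  have G_eq: "G x = (\<lambda>i. \<psi> (x i))" if "x \<in> ?X" for x
    using G[OF that] factor(1) that by (auto simp: inverse_limit_def) metis
  have "f (\<psi> (x (Suc i))) = \<psi> (x i)" if x: "x \<in> ?X" for x i
  proof -
    have "x (Suc i) \<in> K" "f (x (Suc i)) = x i" using x by (auto simp: inverse_limit_def)
    then show ?thesis using factor by metis
  qed
  then have maps: "G ` ?X \<subseteq> ?X"
    using G_eq \<psi>(2) by (auto simp: inverse_limit_def)
  have "Ent ?X G = Ent ?X (\<lambda>x i. \<psi> (x i))" by (rule Ent_cong[OF maps G_eq])
  also have "\<dots> = Ent K \<psi>" using factor by (intro Ent_inverse_limit[OF K f \<psi>]) simp
  finally show ?thesis .
qed

text \<open>Now \<open>f = \<psi> \<circ> g = g \<circ> \<psi>\<close> on \<open>K\<close>, so the coordinatewise action of \<open>\<psi>\<close> undoes \<open>G\<close>.\<close>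

lemma Ent_shifted_backward:
  fixes K :: "'a::metric_space set"
  assumes K: "compact K" "K \<noteq> {}" and f: "continuous_on K f" "f ` K = K"
    and \<psi>: "continuous_on K \<psi>" "\<psi> ` K \<subseteq> K" and g: "g ` K \<subseteq> K"
    and factor: "\<And>x. x \<in> K \<Longrightarrow> \<psi> (g x) = f x" "\<And>x. x \<in> K \<Longrightarrow> g (\<psi> x) = f x"
    and G: "\<And>x. x \<in> inverse_limit K f \<Longrightarrow> G x = (\<lambda>i. g (x (Suc i)))"
  shows "Ent (inverse_limit K f) G = Ent K \<psi>"
proof -
  let ?X = "inverse_limit K f" and ?\<Psi> = "\<lambda>(x :: nat \<Rightarrow> 'a) i. \<psi> (x i)"
  have mem: "x i \<in> K" and shift: "f (x (Suc i)) = x i" if "x \<in> ?X" for x i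
    using that by (auto simp: inverse_limit_def)
  have gK: "g x \<in> K" "\<psi> x \<in> K" if "x \<in> K" for x using that g \<psi>(2) by auto
  have fg: "f (g x) = g (f x)" and f\<psi>: "f (\<psi> x) = \<psi> (f x)" if "x \<in> K" for x
    using factor gK that by metis+
  have G_maps: "G ` ?X \<subseteq> ?X"
  proof (rule image_subsetI)
    fix x assume x: "x \<in> ?X"
    show "G x \<in> ?X"
      unfolding G[OF x] inverse_limit_def using gK(1) mem[OF x] fg shift[OF x] by simp
  qed
  have \<Psi>_maps: "?\<Psi> ` ?X \<subseteq> ?X"
  proof (rule image_subsetI)
    fix x assume x: "x \<in> ?X"
    show "?\<Psi> x \<in> ?X"
      unfolding inverse_limit_def using gK(2) mem[OF x] f\<psi> shift[OF x] by simp
  qed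
  have "Ent ?X G = Ent ?X ?\<Psi>"
  proof (rule Ent_inverse[OF G_maps \<Psi>_maps])
    fix x assume x: "x \<in> ?X"
    show "?\<Psi> (G x) = x" unfolding G[OF x] using factor(1) mem[OF x] shift[OF x] by simp
    have "?\<Psi> x \<in> ?X" using \<Psi>_maps x by blast
    then show "G (?\<Psi> x) = x" using G factor(2) mem[OF x] shift[OF x] by simp
  qed
  also have "\<dots> = Ent K \<psi>" by (rule Ent_inverse_limit[OF K f \<psi> f\<psi>])
  finally show ?thesis .
qed

text \<open>\<open>H\<close> is the power of \<open>h\<close> with the integer exponent \<open>b - a\<close>.\<close>

lemma homeomorphism_power_quotient:
  assumes h: "homeomorphism X X h k"
    and G: "G ` X \<subseteq> X" "\<And>x. x \<in> X \<Longrightarrow> G (h x) = h (G x)"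
  shows "\<exists>H. continuous_on X H \<and> H ` X \<subseteq> X \<and> inj_on H X \<and>
    (\<forall>x\<in>X. G (H x) = H (G x)) \<and> (\<forall>x\<in>X. H ((h ^^ a) x) = (h ^^ b) x \<and> (h ^^ a) (H x) = (h ^^ b) x)"
proof -
  have hk: "k (h x) = x" "h (k x) = x" "h x \<in> X" "k x \<in> X" if "x \<in> X" for x
    using h that unfolding homeomorphism_def by blast+
  have maps: "h ` X \<subseteq> X" "k ` X \<subseteq> X" using hk by auto
  have cont: "continuous_on X h" "continuous_on X k" using h unfolding homeomorphism_def by auto
  have inj: "inj_on h X" "inj_on k X" using hk by (metis inj_onI)+
  have Gk: "G (k x) = k (G x)" if "x \<in> X" for x
  proof -
    have "h (G (k x)) = G x" using G(2)[of "k x"] hk that by simp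
    moreover have "G (k x) \<in> X" using G(1) hk(4)[OF that] by blast
    ultimately show ?thesis using hk(1) by metis
  qed
  show ?thesis
  proof (cases "a \<le> b")
    case True
    have "(h ^^ (b - a)) ((h ^^ a) x) = (h ^^ b) x" "(h ^^ a) ((h ^^ (b - a)) x) = (h ^^ b) x" for x
      using True by (simp_all add: funpow_add_apply)
    moreover have "G ((h ^^ (b - a)) x) = (h ^^ (b - a)) (G x)" if "x \<in> X" for x
      using funpow_commute_on[OF maps(1) _ G(1) that] G(2) by metis
    ultimately show ?thesis
      using continuous_on_funpow[OF cont(1) maps(1)] funpow_in[OF maps(1)]
        inj_on_funpow_on[OF maps(1) inj(1)]
      by (intro exI[of _ "h ^^ (b - a)"]) blast
  next
    case False
    define d where "d = a - b"
    have a: "a = d + b" "a = b + d" using False by (auto simp: d_def)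
    have "(k ^^ d) ((h ^^ a) x) = (h ^^ b) x" "(h ^^ a) ((k ^^ d) x) = (h ^^ b) x" if x: "x \<in> X" for x
    proof -
      show "(k ^^ d) ((h ^^ a) x) = (h ^^ b) x"
        unfolding a(1) using funpow_left_inverse[OF maps(1) hk(1) funpow_in[OF maps(1) x]] by (simp add: funpow_add)
      show "(h ^^ a) ((k ^^ d) x) = (h ^^ b) x"
        unfolding a(2) using funpow_left_inverse[OF maps(2) hk(2) x] by (simp add: funpow_add)
    qed
    moreover have "G ((k ^^ d) x) = (k ^^ d) (G x)" if "x \<in> X" for x
      using funpow_commute_on[OF maps(2) _ G(1) that] Gk by metis
    ultimately show ?thesis
      using continuous_on_funpow[OF cont(2) maps(2)] funpow_in[OF maps(2)]
        inj_on_funpow_on[OF maps(2) inj(2)]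
      by (intro exI[of _ "k ^^ d"]) blast
  qed
qed

text \<open>The quotient of \<open>h\<^sup>b \<circ> \<phi>\<^sup>m\<close> by \<open>h\<^sup>a \<circ> \<phi>\<^sup>n\<close> is \<open>H \<circ> \<phi>\<^sup>m\<^sup>-\<^sup>n\<close>, where \<open>H\<close> is the quotient of \<open>h\<^sup>b\<close> by
  \<open>h\<^sup>a\<close>.\<close>

lemma quotient_map_entropy:
  fixes \<phi> h :: "real \<Rightarrow> real" and a b n m :: nat
  assumes \<phi>: "continuous_on {0..1} \<phi>" "\<phi> ` {0..1} \<subseteq> {0..1}" "piecewise_monotone \<phi>"
    and h: "homeomorphism {0..1} {0..1} h k"
    and comm: "\<And>x. x \<in> {0..1} \<Longrightarrow> \<phi> (h x) = h (\<phi> x)"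
    and nm: "n \<le> m"
  shows "\<exists>\<psi>. continuous_on {0..1} \<psi> \<and> \<psi> ` {0..1} \<subseteq> {0..1} \<and>
    Ent {0..1} \<psi> = ereal (real (m - n)) * Ent {0..1} \<phi> \<and>
    (\<forall>x\<in>{0..1}. \<psi> ((h ^^ a) ((\<phi> ^^ n) x)) = (h ^^ b) ((\<phi> ^^ m) x) \<and>
      (h ^^ a) ((\<phi> ^^ n) (\<psi> x)) = (h ^^ b) ((\<phi> ^^ m) x))"
proof -
  let ?I = "{0..1::real}"
  obtain C where C: "cut_set \<phi> C" using piecewise_monotone_cut_set[OF \<phi>(3)] by blast
  obtain H where H: "continuous_on ?I H" "H ` ?I \<subseteq> ?I" "inj_on H ?I"
    and H_comm: "\<And>x. x \<in> ?I \<Longrightarrow> \<phi> (H x) = H (\<phi> x)"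
    and H_quot: "\<And>x. x \<in> ?I \<Longrightarrow> H ((h ^^ a) x) = (h ^^ b) x"
      "\<And>x. x \<in> ?I \<Longrightarrow> (h ^^ a) (H x) = (h ^^ b) x"
    using homeomorphism_power_quotient[OF h \<phi>(2) comm, of a b] by blast
  have h_maps: "h ` ?I \<subseteq> ?I" using h by (simp add: homeomorphism_def)
  have \<phi>_in: "(\<phi> ^^ j) x \<in> ?I" if "x \<in> ?I" for j x using funpow_in[OF \<phi>(2) that] .
  have ha_in: "(h ^^ a) x \<in> ?I" if "x \<in> ?I" for x using funpow_in[OF h_maps that] .
  have \<phi>h: "\<phi> ((h ^^ a) x) = (h ^^ a) (\<phi> x)" if "x \<in> ?I" for x
    using funpow_commute_on[OF h_maps _ \<phi>(2) that] comm by metis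
  have \<phi>_ha: "(\<phi> ^^ j) ((h ^^ a) x) = (h ^^ a) ((\<phi> ^^ j) x)" if "x \<in> ?I" for j x
    using funpow_commute_on[of \<phi> ?I "h ^^ a" x j] \<phi>(2) \<phi>h ha_in that by blast
  have \<phi>_H: "(\<phi> ^^ j) (H x) = H ((\<phi> ^^ j) x)" if "x \<in> ?I" for j x
    by (rule funpow_commute_on[OF \<phi>(2) H_comm H(2) that])
  have split: "(\<phi> ^^ (m - n)) ((\<phi> ^^ n) x) = (\<phi> ^^ m) x" "(\<phi> ^^ n) ((\<phi> ^^ (m - n)) x) = (\<phi> ^^ m) x" for x
    using nm by (simp_all add: funpow_add_apply)
  let ?\<psi> = "H \<circ> \<phi> ^^ (m - n)"
  have "(\<phi> ^^ (m - n)) ` ?I \<subseteq> ?I" using \<phi>_in by blast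
  then have "continuous_on ?I ?\<psi>" "?\<psi> ` ?I \<subseteq> ?I"
    using continuous_on_compose[OF continuous_on_funpow[OF \<phi>(1,2)] continuous_on_subset[OF H(1)]] H(2)
    unfolding image_comp[symmetric] by blast+
  moreover have "Ent ?I ?\<psi> = ereal (real (m - n)) * Ent ?I \<phi>"
    by (rule Ent_injective_comp_power[OF \<phi>(1,2) C H H_comm])
  moreover have "?\<psi> ((h ^^ a) ((\<phi> ^^ n) x)) = (h ^^ b) ((\<phi> ^^ m) x)"
    "(h ^^ a) ((\<phi> ^^ n) (?\<psi> x)) = (h ^^ b) ((\<phi> ^^ m) x)" if x: "x \<in> ?I" for x
    using \<phi>_ha[OF \<phi>_in[OF x]] \<phi>_H[OF \<phi>_in[OF x]] H_quot[OF \<phi>_in[OF x]] split by simp_all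
  ultimately show ?thesis by blast
qed

theorem corollary5p4:
  fixes \<phi> h f g :: "real \<Rightarrow> real"
    and G :: "(nat \<Rightarrow> real) \<Rightarrow> nat \<Rightarrow> real"
    and a b n m :: nat
  assumes "continuous_on {0..1} \<phi>"
    and "\<phi> ` {0..1} = {0..1}"
    and "piecewise_monotone \<phi>"
    and "\<exists>k. homeomorphism {0..1} {0..1} h k"
    and "\<And>x. x \<in> {0..1} \<Longrightarrow> \<phi> (h x) = h (\<phi> x)"
    and "n \<ge> 1" and "m \<ge> 1"
    and "\<And>x. x \<in> {0..1} \<Longrightarrow> f x = ((h ^^ a) \<circ> (\<phi> ^^ n)) x"
    and "\<And>x. x \<in> {0..1} \<Longrightarrow> g x = ((h ^^ b) \<circ> (\<phi> ^^ m)) x"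
    and "\<And>x. x \<in> inverse_limit {0..1} f \<Longrightarrow> G x = (\<lambda>i. g (x (Suc i)))"
  shows "Ent (inverse_limit {0..1} f) G
    = ereal \<bar>real m - real n\<bar> * Ent {0..1} \<phi>"
proof -
  let ?I = "{0..1::real}"
  obtain k where h: "homeomorphism ?I ?I h k" using assms(4) by blast
  have \<phi>: "continuous_on ?I \<phi>" "\<phi> ` ?I \<subseteq> ?I" using assms(1,2) by auto
  have h_cont: "continuous_on ?I h" and h_onto: "h ` ?I = ?I"
    using h by (auto simp: homeomorphism_def)
  have onto: "(\<phi> ^^ j) ` ?I = ?I" "(h ^^ j) ` ?I = ?I" for j
    using funpow_onto assms(2) h_onto by blast+
  have "continuous_on ?I ((h ^^ a) \<circ> (\<phi> ^^ n))"
    using onto h_onto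
    by (intro continuous_on_compose continuous_on_funpow[OF \<phi>]) (simp add: continuous_on_funpow[OF h_cont])
  then have f_cont: "continuous_on ?I f" by (rule continuous_on_eq) (simp add: assms(8))
  have f_onto: "f ` ?I = ?I"
  proof -
    have "f ` ?I = ((h ^^ a) \<circ> (\<phi> ^^ n)) ` ?I" by (rule image_cong) (simp_all add: assms(8))
    then show ?thesis by (simp only: image_comp[symmetric] onto)
  qed
  have g_onto: "g ` ?I = ?I"
  proof -
    have "g ` ?I = ((h ^^ b) \<circ> (\<phi> ^^ m)) ` ?I" by (rule image_cong) (simp_all add: assms(9))
    then show ?thesis by (simp only: image_comp[symmetric] onto)
  qed
  have I: "compact ?I" "?I \<noteq> {}" by auto
  show ?thesis
  proof (cases "n \<le> m")
    case True
    obtain \<psi> where \<psi>: "continuous_on ?I \<psi>" "\<psi> ` ?I \<subseteq> ?I"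
      "Ent ?I \<psi> = ereal (real (m - n)) * Ent ?I \<phi>"
      "\<And>x. x \<in> ?I \<Longrightarrow> \<psi> (f x) = g x" "\<And>x. x \<in> ?I \<Longrightarrow> f (\<psi> x) = g x"
      using quotient_map_entropy[OF \<phi> assms(3) h assms(5) True, of a b] assms(8,9)
      by (auto simp: image_subset_iff)
    have "Ent (inverse_limit ?I f) G = Ent ?I \<psi>"
      by (rule Ent_shifted_forward[OF I f_cont f_onto \<psi>(1,2,4,5) assms(10)])
    then show ?thesis using \<psi>(3) True by (simp add: of_nat_diff)
  next
    case False
    then have mn: "m \<le> n" by simp
    obtain \<psi> where \<psi>: "continuous_on ?I \<psi>" "\<psi> ` ?I \<subseteq> ?I"
      "Ent ?I \<psi> = ereal (real (n - m)) * Ent ?I \<phi>"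
      "\<And>x. x \<in> ?I \<Longrightarrow> \<psi> (g x) = f x" "\<And>x. x \<in> ?I \<Longrightarrow> g (\<psi> x) = f x"
      using quotient_map_entropy[OF \<phi> assms(3) h assms(5) mn, of b a] assms(8,9)
      by (auto simp: image_subset_iff)
    have "Ent (inverse_limit ?I f) G = Ent ?I \<psi>"
      using g_onto by (intro Ent_shifted_backward[OF I f_cont f_onto \<psi>(1,2) _ \<psi>(4,5) assms(10)]) auto
    then show ?thesis using \<psi>(3) mn by (simp add: of_nat_diff)
  qed
qed

end
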